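(* Let $K$ be a field and let $E$ be an arbitrary directed graph. Then the Leavitt path algebra $\mathcal{L}_K(E)$, equipped with its canonical $\mathbb{Z}$-grading, is a graded von Neumann regular ring; that is, for every homogeneous element $x\in \mathcal{L}_K(E)$ there exists $y\in \mathcal{L}_K(E)$ such that $xyx=x$.
   Context: Rings are not assumed to be unital. A ring $A$ graded by a group $\Gamma$, $A=\bigoplus_{\gamma\in\Gamma}A_\gamma$ with $A_\gamma A_\delta\subseteq A_{\gamma+\delta}$, has set of homogeneous elements $A^h=\bigcup_{\gamma\in\Gamma}A_\gamma$. It is called graded von Neumann regular if for every $x\in A^h$ there is $y\in A$ with $xyx=x$. A directed graph $E=(E^0,E^1,r,s)$ consists of two sets $E^0$ (vertices) and $E^1$ (edges), of arbitrary cardinality, and maps $r,s:E^1\to E^0$ (range and source). A vertex $v$ is a sink if $s^{-1}(v)=\emptyset$, an infinite emitter if $s^{-1}(v)$ is infinite, and regular if it is neither, i.e. if $s^{-1}(v)$ is finite and non-empty. For a field $K$, the Leavitt path algebra $\mathcal{L}_K(E)$ is the (associative, not necessarily unital) $K$-algebra generated by $\{v\mid v\in E^0\}\cup\{\alpha\mid\alpha\in E^1\}\cup\{\alpha^*\mid\alpha\in E^1\}$ subject to the relations: (1) $v_iv_j=\delta_{ij}v_i$ for all $v_i,v_j\in E^0$; (2) $s(\alpha)\alpha=\alpha r(\alpha)=\alpha$ and $r(\alpha)\alpha^*=\alpha^*s(\alpha)=\alpha^*$ for all $\alpha\in E^1$; (3) $\alpha^*\alpha'=\delta_{\alpha\alpha'}r(\alpha)$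 for all $\alpha,\alpha'\in E^1$; (4) $\sum_{\{\alpha\in E^1:\, s(\alpha)=v\}}\alpha\alpha^*=v$ for every regular vertex $v\in E^0$. The canonical $\mathbb{Z}$-grading on $\mathcal{L}_K(E)$ is the one induced by $\deg(v)=0$ for $v\in E^0$, and $\deg(\alpha)=1$, $\deg(\alpha^* )=-1$ for $\alpha\in E^1$. *)

theory Defs
  imports
    "HOL-Algebra.QuotRing"
    "HOL-Library.Poly_Mapping"
    "Graph_Theory.Digraph"
begin

section \<open>Graded von Neumann regular rings, without unit\<close>

text \<open>
  The record type of HOL-Algebra is used for rings that need not have a unit; its field \<open>one\<close>
  then carries no meaning, and nothing below refers to it.
\<close>

locale nonunital_ring = abelian_group R for R (structure) +
  assumes mult_closed: "\<lbrakk>x \<in> carrier R; y \<in> carrier R\<rbrakk> \<Longrightarrow> x \<otimes> y \<in> carrier R"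
    and mult_assoc: "\<lbrakk>x \<in> carrier R; y \<in> carrier R; z \<in> carrier R\<rbrakk>
      \<Longrightarrow> (x \<otimes> y) \<otimes> z = x \<otimes> (y \<otimes> z)"
    and distrib_right: "\<lbrakk>x \<in> carrier R; y \<in> carrier R; z \<in> carrier R\<rbrakk>
      \<Longrightarrow> (x \<oplus> y) \<otimes> z = x \<otimes> z \<oplus> y \<otimes> z"
    and distrib_left: "\<lbrakk>x \<in> carrier R; y \<in> carrier R; z \<in> carrier R\<rbrakk>
      \<Longrightarrow> z \<otimes> (x \<oplus> y) = z \<otimes> x \<oplus> z \<otimes> y"

locale graded_ring = nonunital_ring R for R (structure) +
  fixes A :: "'g::group_add \<Rightarrow> 'a set"
  assumes component_subgroup: "additive_subgroup (A \<gamma>) R"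
    and component_mult: "\<lbrakk>x \<in> A \<gamma>; y \<in> A \<delta>\<rbrakk> \<Longrightarrow> x \<otimes> y \<in> A (\<gamma> + \<delta>)"
    and direct_sum: "x \<in> carrier R \<Longrightarrow>
      \<exists>!f. (\<forall>\<gamma>. f \<gamma> \<in> A \<gamma>) \<and> finite {\<gamma>. f \<gamma> \<noteq> \<zero>} \<and>
           x = (\<Oplus>\<gamma>\<in>{\<gamma>. f \<gamma> \<noteq> \<zero>}. f \<gamma>)"

definition homogeneous_elements :: "('g \<Rightarrow> 'a set) \<Rightarrow> 'a set" where
  "homogeneous_elements A = (\<Union>\<gamma>. A \<gamma>)"

definition graded_von_neumann_regular ::
    "('a, 'm) ring_scheme \<Rightarrow> ('g::group_add \<Rightarrow> 'a set) \<Rightarrow> bool" where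
  "graded_von_neumann_regular R A \<longleftrightarrow>
     graded_ring R A \<and>
     (\<forall>x \<in> homogeneous_elements A. \<exists>y \<in> carrier R. x \<otimes>\<^bsub>R\<^esub> y \<otimes>\<^bsub>R\<^esub> x = x)"


section \<open>The free algebra\<close>

datatype ('v, 'e) lpa_gen = Vertex 'v | Edge 'e | Ghost 'e

text \<open>
  A copy of the list type that carries the free monoid structure, written additively because the
  convolution product of \<^typ>\<open>'m \<Rightarrow>\<^sub>0 'k\<close> expects exponents in \<^class>\<open>monoid_add\<close>.
\<close>

datatype 'x word = Word (letters: "'x list")

instantiation word :: (type) monoid_add
begin

definition zero_word :: "'x word" where
  "zero_word = Word []"

definition plus_word :: "'x word \<Rightarrow> 'x word \<Rightarrow> 'x word" where
  "plus_word u v = Word (letters u @ letters v)"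

instance
  by standard (simp_all add: zero_word_def plus_word_def)

end

type_synonym ('v, 'e, 'k) lpa_poly = "('v, 'e) lpa_gen word \<Rightarrow>\<^sub>0 'k"

definition lpa_gens :: "('v, 'e) pre_digraph \<Rightarrow> ('v, 'e) lpa_gen set" where
  "lpa_gens G = Vertex ` verts G \<union> Edge ` arcs G \<union> Ghost ` arcs G"

text \<open>
  The free algebra has no unit: its basis consists of the nonempty words in the generators.
\<close>

definition free_carrier :: "('v, 'e) pre_digraph \<Rightarrow> ('v, 'e, 'k::field) lpa_poly set" where
  "free_carrier G =
     {p. \<forall>w \<in> Poly_Mapping.keys p. letters w \<noteq> [] \<and> set (letters w) \<subseteq> lpa_gens G}"

definition free_algebra :: "('v, 'e) pre_digraph \<Rightarrow> ('v, 'e, 'k::field) lpa_poly ring" where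
  "free_algebra G =
     \<lparr>carrier = free_carrier G, mult = (*), one = 0, zero = 0, add = (+)\<rparr>"

definition scale :: "'k::field \<Rightarrow> ('v, 'e, 'k) lpa_poly \<Rightarrow> ('v, 'e, 'k) lpa_poly" where
  "scale c p = Poly_Mapping.map ((*) c) p"

definition gen :: "('v, 'e) lpa_gen \<Rightarrow> ('v, 'e, 'k::field) lpa_poly" where
  "gen x = Poly_Mapping.single (Word [x]) 1"


section \<open>Leavitt path algebras\<close>

text \<open>
  For an edge \<open>e\<close>, \<^term>\<open>tail G e\<close> is its source and \<^term>\<open>head G e\<close> its range.
\<close>

definition regular_vertex :: "('v, 'e) pre_digraph \<Rightarrow> 'v \<Rightarrow> bool" where
  "regular_vertex G v \<longleftrightarrow> v \<in> verts G \<and> finite (out_arcs G v) \<and> out_arcs G v \<noteq> {}"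

inductive_set lpa_relators :: "('v, 'e) pre_digraph \<Rightarrow> ('v, 'e, 'k::field) lpa_poly set"
  for G :: "('v, 'e) pre_digraph" where
  vertices: "\<lbrakk>v \<in> verts G; w \<in> verts G\<rbrakk> \<Longrightarrow>
    gen (Vertex v) * gen (Vertex w) - (if v = w then gen (Vertex v) else 0) \<in> lpa_relators G"
| source_edge: "e \<in> arcs G \<Longrightarrow>
    gen (Vertex (tail G e)) * gen (Edge e) - gen (Edge e) \<in> lpa_relators G"
| edge_range: "e \<in> arcs G \<Longrightarrow>
    gen (Edge e) * gen (Vertex (head G e)) - gen (Edge e) \<in> lpa_relators G"
| range_ghost: "e \<in> arcs G \<Longrightarrow>
    gen (Vertex (head G e)) * gen (Ghost e) - gen (Ghost e) \<in> lpa_relators G"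
| ghost_source: "e \<in> arcs G \<Longrightarrow>
    gen (Ghost e) * gen (Vertex (tail G e)) - gen (Ghost e) \<in> lpa_relators G"
| ghost_edge: "\<lbrakk>e \<in> arcs G; f \<in> arcs G\<rbrakk> \<Longrightarrow>
    gen (Ghost e) * gen (Edge f) - (if e = f then gen (Vertex (head G e)) else 0)
      \<in> lpa_relators G"
| regular: "regular_vertex G v \<Longrightarrow>
    (\<Sum>e \<in> out_arcs G v. gen (Edge e) * gen (Ghost e)) - gen (Vertex v) \<in> lpa_relators G"

text \<open>
  The algebra ideal generated by the relators.  Closure under scalars has to be required
  separately, since the free algebra has no unit.
\<close>

inductive_set lpa_ideal :: "('v, 'e) pre_digraph \<Rightarrow> ('v, 'e, 'k::field) lpa_poly set"
  for G :: "('v, 'e) pre_digraph" where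
  relator: "p \<in> lpa_relators G \<Longrightarrow> p \<in> lpa_ideal G"
| zero: "0 \<in> lpa_ideal G"
| add: "\<lbrakk>p \<in> lpa_ideal G; q \<in> lpa_ideal G\<rbrakk> \<Longrightarrow> p + q \<in> lpa_ideal G"
| scalar: "p \<in> lpa_ideal G \<Longrightarrow> scale c p \<in> lpa_ideal G"
| left: "\<lbrakk>a \<in> free_carrier G; p \<in> lpa_ideal G\<rbrakk> \<Longrightarrow> a * p \<in> lpa_ideal G"
| right: "\<lbrakk>p \<in> lpa_ideal G; a \<in> free_carrier G\<rbrakk> \<Longrightarrow> p * a \<in> lpa_ideal G"

definition leavitt_path_algebra ::
    "('v, 'e) pre_digraph \<Rightarrow> ('v, 'e, 'k::field) lpa_poly set ring" where
  "leavitt_path_algebra G = free_algebra G Quot lpa_ideal G"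

fun gen_degree :: "('v, 'e) lpa_gen \<Rightarrow> int" where
  "gen_degree (Vertex v) = 0"
| "gen_degree (Edge e) = 1"
| "gen_degree (Ghost e) = -1"

definition word_degree :: "('v, 'e) lpa_gen word \<Rightarrow> int" where
  "word_degree w = (\<Sum>x \<leftarrow> letters w. gen_degree x)"

definition free_component ::
    "('v, 'e) pre_digraph \<Rightarrow> int \<Rightarrow> ('v, 'e, 'k::field) lpa_poly set" where
  "free_component G n = {p \<in> free_carrier G. \<forall>w \<in> Poly_Mapping.keys p. word_degree w = n}"

definition lpa_component ::
    "('v, 'e) pre_digraph \<Rightarrow> int \<Rightarrow> ('v, 'e, 'k::field) lpa_poly set set" where
  "lpa_component G n = (\<lambda>p. lpa_ideal G +>\<^bsub>free_algebra G\<^esub> p) ` free_component G n"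

end

theory Submission
  imports Defs "Graph_Theory.Arc_Walk"
begin

text \<open>
  The Leavitt path algebra is spanned by the elements \<open>\<alpha> \<beta>\<^sup>*\<close>, where \<open>\<alpha>\<close> and \<open>\<beta>\<close> are paths with the
  same range, of degree \<open>|\<alpha>| - |\<beta>|\<close>.  A homogeneous element \<open>x\<close> is a linear combination of finitely
  many of them, so it involves only a finite set \<open>F\<close> of edges and paths of bounded length.  For a
  vertex \<open>v\<close> put \<open>q\<^sub>v = v - (\<Sum>e\<in>F, s(e) = v. e e\<^sup>*)\<close>, an idempotent with \<open>q\<^sub>v e = 0 = e\<^sup>* q\<^sub>v\<close> for
  all \<open>e \<in> F\<close>.  Writing \<open>v = q\<^sub>v + (\<Sum>e\<in>F, s(e) = v. e e\<^sup>*)\<close> and repeating this up to a top level,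
  \<open>x\<close> becomes a combination of elements \<open>\<alpha> q\<^sub>v \<beta>\<^sup>*\<close>, and of elements \<open>\<alpha> v \<beta>\<^sup>*\<close> with \<open>\<alpha>\<close> and \<open>\<beta>\<close> of
  maximal length (\<open>in_span_monomial\<close>).  These multiply like matrix units (\<open>rgt_lft\<close>), so \<open>x\<close> is the
  image of a finite block diagonal matrix over the field, whose blocks are rectangular in general.
  Every matrix \<open>C\<close> over a field has a \<open>D\<close> with \<open>C D C = C\<close>; here this is proved in the algebra
  itself, by Gaussian elimination (\<open>regular_matrix\<close>).  Since \<open>q\<^sub>v\<close> is allowed to be \<open>0\<close>, this needs
  neither a basis of the algebra nor the relation \<open>(\<Sum>s(e) = v. e e\<^sup>*) = v\<close> at regular vertices, and
  infinite emitters need no special treatment.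

  All computations are congruences in the unital ring of all polynomials in noncommuting letters.
  That the quotient is graded holds because the ideal of relations is generated by homogeneous
  elements, so that it contains the homogeneous components of its members (\<open>component_ideal\<close>).
\<close>


section \<open>Restricting polynomials to a set of words\<close>

lemma letters_zero [simp]: "letters 0 = []"
  by (simp add: zero_word_def)

lemma letters_plus [simp]: "letters (u + v) = letters u @ letters v"
  by (simp add: plus_word_def)

lemma letters_eq_Nil_iff [simp]: "letters w = [] \<longleftrightarrow> w = 0"
  by (cases w) (simp add: zero_word_def)

lemma word_degree_zero [simp]: "word_degree 0 = 0"
  by (simp add: word_degree_def)

lemma word_degree_plus [simp]: "word_degree (u + v) = word_degree u + word_degree v"
  by (simp add: word_degree_def)

lemma sum_monomials: "(\<Sum>w\<in>Poly_Mapping.keys p. Poly_Mapping.single w (Poly_Mapping.lookup p w)) = p"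
proof (rule poly_mapping_eqI)
  fix k
  show "Poly_Mapping.lookup (\<Sum>w\<in>Poly_Mapping.keys p. Poly_Mapping.single w (Poly_Mapping.lookup p w)) k
      = Poly_Mapping.lookup p k"
    by (auto simp: lookup_sum lookup_single when_def in_keys_iff sum.delta)
qed

lemma monomial_induct [case_names zero single add]:
  fixes p :: "'a \<Rightarrow>\<^sub>0 'b::comm_monoid_add"
  assumes "Q 0"
    and "\<And>w. w \<in> Poly_Mapping.keys p \<Longrightarrow> Q (Poly_Mapping.single w (Poly_Mapping.lookup p w))"
    and "\<And>p q. Q p \<Longrightarrow> Q q \<Longrightarrow> Q (p + q)"
  shows "Q p"
proof -
  have "Q (\<Sum>w\<in>A. Poly_Mapping.single w (Poly_Mapping.lookup p w))"
    if "finite A" "A \<subseteq> Poly_Mapping.keys p" for A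
    using that by (induction A) (auto intro: assms)
  from this[OF finite_keys order_refl] show ?thesis
    by (simp add: sum_monomials)
qed

text \<open>
  The part of a polynomial supported on the words that satisfy \<open>P\<close>.  For \<open>P\<close> the words of a given
  degree this is the projection onto a homogeneous component; for \<open>P\<close> the words in the generators
  it is a ring homomorphism.
\<close>

definition restr :: "('a \<Rightarrow> bool) \<Rightarrow> ('a \<Rightarrow>\<^sub>0 'b::zero) \<Rightarrow> ('a \<Rightarrow>\<^sub>0 'b)" where
  "restr P p = Poly_Mapping.mapp (\<lambda>w c. if P w then c else 0) p"

lemma lookup_restr: "Poly_Mapping.lookup (restr P p) w = (if P w then Poly_Mapping.lookup p w else 0)"
  by (auto simp: restr_def lookup_mapp when_def in_keys_iff)

lemma keys_restr: "Poly_Mapping.keys (restr P p) = {w \<in> Poly_Mapping.keys p. P w}"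
  by (auto simp: in_keys_iff lookup_restr split: if_splits)

lemma restr_zero [simp]: "restr P 0 = 0"
  by (rule poly_mapping_eqI) (simp add: lookup_restr)

lemma restr_single:
  "restr P (Poly_Mapping.single w c) = (if P w then Poly_Mapping.single w c else 0)"
  by (rule poly_mapping_eqI) (auto simp: lookup_restr lookup_single when_def)

lemma restr_add: "restr P (p + q) = restr P p + restr P (q :: 'a \<Rightarrow>\<^sub>0 'b::monoid_add)"
  by (rule poly_mapping_eqI) (simp add: lookup_restr lookup_add)

lemma restr_diff: "restr P (p - q) = restr P p - restr P (q :: 'a \<Rightarrow>\<^sub>0 'b::ab_group_add)"
  by (rule poly_mapping_eqI) (simp add: lookup_restr lookup_minus)

lemma restr_sum: "restr P (\<Sum>i\<in>A. f i) = (\<Sum>i\<in>A. restr P (f i :: 'a \<Rightarrow>\<^sub>0 'b::comm_monoid_add))"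
  by (induction A rule: infinite_finite_induct) (simp_all add: restr_add)

lemma restr_id: "(\<And>w. w \<in> Poly_Mapping.keys p \<Longrightarrow> P w) \<Longrightarrow> restr P p = p"
  by (rule poly_mapping_eqI) (auto simp: lookup_restr in_keys_iff)

lemma restr_none: "(\<And>w. w \<in> Poly_Mapping.keys p \<Longrightarrow> \<not> P w) \<Longrightarrow> restr P p = 0"
  by (rule poly_mapping_eqI) (auto simp: lookup_restr in_keys_iff)

lemma restr_mult:
  fixes p q :: "'a::monoid_add \<Rightarrow>\<^sub>0 'b::semiring_0"
  assumes "\<And>u v. P (u + v) \<longleftrightarrow> P u \<and> P v"
  shows "restr P (p * q) = restr P p * restr P q"
proof (induction p rule: monomial_induct)
  case (single u)
  show ?case
    by (induction q rule: monomial_induct)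
      (auto simp: mult_single restr_single assms restr_add distrib_left)
qed (simp_all add: restr_add distrib_right)

lemma scale_eq_mult: "scale c p = Poly_Mapping.single 0 c * p"
  by (simp add: scale_def mult_map_scale_conv_mult)

text \<open>
  The polynomial with constant term \<open>c\<close> only.  It lies outside the carrier of the free algebra,
  which has no unit, but inside the ambient unital ring in which all computations take place.
\<close>

definition const :: "'k::field \<Rightarrow> ('v, 'e, 'k) lpa_poly" where
  "const c = Poly_Mapping.single 0 c"

lemma const_0 [simp]: "const 0 = 0" and const_1 [simp]: "const 1 = 1"
  by (simp_all add: const_def)

lemma const_add: "const (a + b) = const a + const b"
  and const_diff: "const (a - b) = const a - const b"
  and const_mult: "const (a * b) = const a * const b"
  by (simp_all add: const_def single_add single_diff mult_single)

lemma const_commute: "const c * p = p * const c"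
proof (induction p rule: monomial_induct)
  case (single w)
  show ?case by (simp add: const_def mult_single mult.commute)
qed (simp_all add: distrib_left distrib_right)

lemma const_left_commute: "p * (const c * q) = const c * (p * q)"
  by (metis const_commute mult.assoc)


section \<open>Congruence modulo the defining relations\<close>

text \<open>
  The words in the generators of the Leavitt path algebra.  The type of words also contains letters
  for elements that are no vertices or arcs of \<open>G\<close>.
\<close>

definition over_gens :: "('v, 'e) pre_digraph \<Rightarrow> ('v, 'e) lpa_gen word \<Rightarrow> bool" where
  "over_gens G w \<longleftrightarrow> set (letters w) \<subseteq> lpa_gens G"

lemma over_gens_zero [simp]: "over_gens G 0"
  by (simp add: over_gens_def)

lemma over_gens_plus [simp]: "over_gens G (u + v) \<longleftrightarrow> over_gens G u \<and> over_gens G v"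
  by (simp add: over_gens_def)

lemma free_carrier_iff:
  "p \<in> free_carrier G \<longleftrightarrow> (\<forall>w\<in>Poly_Mapping.keys p. w \<noteq> 0 \<and> over_gens G w)"
  by (simp add: free_carrier_def over_gens_def)

lemma free_carrier_zero: "0 \<in> free_carrier G"
  by (simp add: free_carrier_iff)

lemma free_carrier_add: "p \<in> free_carrier G \<Longrightarrow> q \<in> free_carrier G \<Longrightarrow> p + q \<in> free_carrier G"
  using keys_add[of p q] by (force simp: free_carrier_iff)

lemma free_carrier_diff: "p \<in> free_carrier G \<Longrightarrow> q \<in> free_carrier G \<Longrightarrow> p - q \<in> free_carrier G"
proof -
  have "Poly_Mapping.keys (p - q) \<subseteq> Poly_Mapping.keys p \<union> Poly_Mapping.keys q"
    by (auto simp: in_keys_iff lookup_minus)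
  then show "p \<in> free_carrier G \<Longrightarrow> q \<in> free_carrier G \<Longrightarrow> p - q \<in> free_carrier G"
    unfolding free_carrier_iff by blast
qed

lemma free_carrier_uminus: "p \<in> free_carrier G \<Longrightarrow> - p \<in> free_carrier G"
  using free_carrier_diff[OF free_carrier_zero] by fastforce

lemma free_carrier_sum: "(\<And>i. i \<in> A \<Longrightarrow> f i \<in> free_carrier G) \<Longrightarrow> sum f A \<in> free_carrier G"
  by (induction A rule: infinite_finite_induct) (auto simp: free_carrier_zero free_carrier_add)

lemma word_plus_eq_0_iff: "u + v = 0 \<longleftrightarrow> u = 0 \<and> v = (0 :: 'x word)"
  by (metis append_is_Nil_conv letters_eq_Nil_iff letters_plus)

lemma free_carrier_mult_left:
  assumes "\<forall>w\<in>Poly_Mapping.keys a. over_gens G w" "p \<in> free_carrier G"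
  shows "a * p \<in> free_carrier G" "p * a \<in> free_carrier G"
  using assms keys_mult[of a p] keys_mult[of p a]
  by (fastforce simp: free_carrier_iff word_plus_eq_0_iff)+

lemma free_carrier_mult: "p \<in> free_carrier G \<Longrightarrow> q \<in> free_carrier G \<Longrightarrow> p * q \<in> free_carrier G"
  by (rule free_carrier_mult_left) (auto simp: free_carrier_iff)

lemma free_carrier_scale: "p \<in> free_carrier G \<Longrightarrow> scale c p \<in> free_carrier G"
  unfolding scale_eq_mult
  by (rule free_carrier_mult_left) (auto split: if_splits)

lemma gen_free_carrier: "x \<in> lpa_gens G \<Longrightarrow> gen x \<in> free_carrier G"
  by (auto simp del: letters_eq_Nil_iff simp: gen_def free_carrier_def)

lemma lpa_ideal_uminus: "p \<in> lpa_ideal G \<Longrightarrow> - p \<in> lpa_ideal G"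
  using lpa_ideal.scalar[of p G "-1"] by (simp add: scale_eq_mult single_uminus)

lemma lpa_ideal_diff: "p \<in> lpa_ideal G \<Longrightarrow> q \<in> lpa_ideal G \<Longrightarrow> p - q \<in> lpa_ideal G"
  using lpa_ideal.add[OF _ lpa_ideal_uminus] by fastforce

lemma lpa_ideal_sum: "(\<And>i. i \<in> A \<Longrightarrow> f i \<in> lpa_ideal G) \<Longrightarrow> sum f A \<in> lpa_ideal G"
  by (induction A rule: infinite_finite_induct) (auto intro: lpa_ideal.zero lpa_ideal.add)

text \<open>
  The ideal also absorbs polynomials with a constant term, because it is closed under scalars.
\<close>

lemma lpa_ideal_absorb:
  assumes "\<And>w. w \<in> Poly_Mapping.keys a \<Longrightarrow> over_gens G w" "p \<in> lpa_ideal G"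
  shows "a * p \<in> lpa_ideal G \<and> p * a \<in> lpa_ideal G"
proof (induction a rule: monomial_induct)
  case (single w)
  let ?c = "Poly_Mapping.lookup a w"
  show ?case
  proof (cases "w = 0")
    case True
    then show ?thesis
      using lpa_ideal.scalar[OF assms(2), of ?c] const_commute[of ?c p]
      by (simp add: scale_eq_mult const_def)
  next
    case False
    then have "Poly_Mapping.single w ?c \<in> free_carrier G"
      using assms(1)[OF single] by (auto simp: free_carrier_iff split: if_splits)
    then show ?thesis using assms(2) by (auto intro: lpa_ideal.left lpa_ideal.right)
  qed
qed (auto simp: distrib_left distrib_right intro: lpa_ideal.zero lpa_ideal.add)

text \<open>
  Congruence modulo the ideal, extended to the whole unital ring of polynomials: words that
  contain a letter outside the generators count as \<open>0\<close>.  This makes it a ring congruence without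
  side conditions.
\<close>

definition lpa_cong ::
    "('v, 'e) pre_digraph \<Rightarrow> ('v, 'e, 'k::field) lpa_poly \<Rightarrow> ('v, 'e, 'k) lpa_poly \<Rightarrow> bool" where
  "lpa_cong G p q \<longleftrightarrow> restr (over_gens G) (p - q) \<in> lpa_ideal G"

lemma restr_over_gens_mult:
  "restr (over_gens G) (p * q) = restr (over_gens G) p * restr (over_gens G) q"
  by (rule restr_mult) simp

lemma restr_over_gens_free_carrier: "p \<in> free_carrier G \<Longrightarrow> restr (over_gens G) p = p"
  by (rule restr_id) (simp add: free_carrier_iff)

lemma over_gens_keys_restr: "w \<in> Poly_Mapping.keys (restr (over_gens G) p) \<Longrightarrow> over_gens G w"
  by (simp add: keys_restr)

text \<open>The parameter \<open>K\<close> only fixes the field of coefficients.\<close>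

locale leavitt = wf_digraph G for G :: "('v, 'e) pre_digraph" +
  fixes K :: "'k::field itself"
begin

abbreviation cong :: "('v, 'e, 'k) lpa_poly \<Rightarrow> ('v, 'e, 'k) lpa_poly \<Rightarrow> bool"
    (infix "\<approx>" 50) where
  "p \<approx> q \<equiv> lpa_cong G p q"

lemma cong_refl [simp, intro]: "p \<approx> p"
  by (simp add: lpa_cong_def lpa_ideal.zero)

lemma cong_sym: "p \<approx> q \<Longrightarrow> q \<approx> p"
  unfolding lpa_cong_def by (metis lpa_ideal_uminus minus_diff_eq restr_diff)

lemma cong_add: "p \<approx> q \<Longrightarrow> p' \<approx> q' \<Longrightarrow> p + p' \<approx> q + q'"
  unfolding lpa_cong_def
  by (drule (1) lpa_ideal.add) (simp add: restr_add[symmetric] algebra_simps)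

lemma cong_diff: "p \<approx> q \<Longrightarrow> p' \<approx> q' \<Longrightarrow> p - p' \<approx> q - q'"
  unfolding lpa_cong_def
  by (drule (1) lpa_ideal_diff) (simp add: restr_diff[symmetric] algebra_simps)

lemma cong_trans [trans]: "p \<approx> q \<Longrightarrow> q \<approx> r \<Longrightarrow> p \<approx> r"
  unfolding lpa_cong_def
  by (drule (1) lpa_ideal.add) (simp add: restr_add[symmetric])

lemma cong_sum: "(\<And>i. i \<in> A \<Longrightarrow> f i \<approx> g i) \<Longrightarrow> sum f A \<approx> sum g A"
  by (induction A rule: infinite_finite_induct) (auto intro: cong_add)

lemma cong_mult_left: "p \<approx> q \<Longrightarrow> a * p \<approx> a * q"
  unfolding lpa_cong_def right_diff_distrib[symmetric] restr_over_gens_mult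
  using lpa_ideal_absorb over_gens_keys_restr by blast

lemma cong_mult_right: "p \<approx> q \<Longrightarrow> p * a \<approx> q * a"
  unfolding lpa_cong_def left_diff_distrib[symmetric] restr_over_gens_mult
  using lpa_ideal_absorb over_gens_keys_restr by blast

lemma cong_mult: "p \<approx> q \<Longrightarrow> p' \<approx> q' \<Longrightarrow> p * p' \<approx> q * q'"
  using cong_mult_left cong_mult_right cong_trans by blast

lemma cong_mid: "p \<approx> q \<Longrightarrow> a * p * b \<approx> a * q * b"
  by (intro cong_mult_left cong_mult_right)

lemma lpa_relators_free_carrier:
  assumes "p \<in> lpa_relators G"
  shows "p \<in> free_carrier G"
  using assms
proof cases
  case (regular v)
  then show ?thesis
    by (auto intro!: free_carrier_diff free_carrier_sum free_carrier_mult gen_free_carrier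
        simp: lpa_gens_def regular_vertex_def)
qed (auto intro!: free_carrier_diff free_carrier_mult gen_free_carrier free_carrier_zero
      simp: lpa_gens_def)

lemma lpa_ideal_free_carrier: "p \<in> lpa_ideal G \<Longrightarrow> p \<in> free_carrier G"
  by (induction rule: lpa_ideal.induct)
    (auto intro: lpa_relators_free_carrier free_carrier_zero free_carrier_add
      free_carrier_scale free_carrier_mult)

lemma cong_iff_ideal:
  "p \<in> free_carrier G \<Longrightarrow> q \<in> free_carrier G \<Longrightarrow> p \<approx> q \<longleftrightarrow> p - q \<in> lpa_ideal G"
  by (simp add: lpa_cong_def restr_over_gens_free_carrier free_carrier_diff)

lemma relator_cong: "p - q \<in> lpa_relators G \<Longrightarrow> p \<approx> q"
  using lpa_relators_free_carrier[of "p - q"]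
  by (simp add: lpa_cong_def restr_over_gens_free_carrier lpa_ideal.relator)

lemma gen_not_over: "x \<notin> lpa_gens G \<Longrightarrow> gen x \<approx> 0"
  by (simp add: lpa_cong_def gen_def restr_single over_gens_def lpa_ideal.zero)

abbreviation vx :: "'v \<Rightarrow> ('v, 'e, 'k) lpa_poly" where "vx v \<equiv> gen (Vertex v)"
abbreviation ed :: "'e \<Rightarrow> ('v, 'e, 'k) lpa_poly" where "ed e \<equiv> gen (Edge e)"
abbreviation gh :: "'e \<Rightarrow> ('v, 'e, 'k) lpa_poly" where "gh e \<equiv> gen (Ghost e)"

lemma cong_0_mult: "p \<approx> 0 \<Longrightarrow> p * q \<approx> 0" "p \<approx> 0 \<Longrightarrow> q * p \<approx> 0"
  using cong_mult_right[of p 0 q] cong_mult_left[of p 0 q] by simp_all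

lemma vx_idem: "vx v * vx v \<approx> vx v"
proof (cases "v \<in> verts G")
  case True
  then show ?thesis using lpa_relators.vertices[of v G v] by (intro relator_cong) simp
next
  case False
  then have "vx v \<approx> 0" by (intro gen_not_over) (auto simp: lpa_gens_def)
  then show ?thesis using cong_0_mult cong_sym cong_trans by blast
qed

lemma vx_orth: "v \<noteq> w \<Longrightarrow> vx v * vx w \<approx> 0"
proof (cases "v \<in> verts G \<and> w \<in> verts G")
  case True
  moreover assume "v \<noteq> w"
  ultimately show ?thesis using lpa_relators.vertices[of v G w] by (intro relator_cong) simp
next
  case False
  then have "vx v \<approx> 0 \<or> vx w \<approx> 0" by (auto intro!: gen_not_over simp: lpa_gens_def)
  then show ?thesis using cong_0_mult by blast
qed

lemma
  assumes "e \<in> arcs G"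
  shows tail_ed: "vx (tail G e) * ed e \<approx> ed e"
    and ed_head: "ed e * vx (head G e) \<approx> ed e"
    and head_gh: "vx (head G e) * gh e \<approx> gh e"
    and gh_tail: "gh e * vx (tail G e) \<approx> gh e"
    and gh_ed: "gh e * ed e \<approx> vx (head G e)"
    and gh_ed_orth: "f \<in> arcs G \<Longrightarrow> e \<noteq> f \<Longrightarrow> gh e * ed f \<approx> 0"
  using assms lpa_relators.ghost_edge[of e G e] lpa_relators.ghost_edge[of e G f]
  by (auto intro!: relator_cong intro: lpa_relators.intros)

end


section \<open>Products of paths and ghost paths\<close>

text \<open>
  For a list \<open>\<alpha>\<close> of edges, \<open>edges \<alpha>\<close> and \<open>ghosts \<alpha>\<close> are the monomials \<open>\<alpha>\<close> and \<open>\<alpha>\<^sup>*\<close>.  Both are \<open>1\<close>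
  for the empty list, which does not remember a vertex; the vertex is therefore always written as a
  separate factor, and a typical spanning element \<open>\<alpha> \<beta>\<^sup>*\<close> becomes \<open>edges \<alpha> * vx v * ghosts \<beta>\<close> with
  \<open>v\<close> the common range of \<open>\<alpha>\<close> and \<open>\<beta>\<close>.
\<close>

definition edges :: "'e list \<Rightarrow> ('v, 'e, 'k::field) lpa_poly" where
  "edges es = prod_list (map (\<lambda>e. gen (Edge e)) es)"

definition ghosts :: "'e list \<Rightarrow> ('v, 'e, 'k::field) lpa_poly" where
  "ghosts es = prod_list (map (\<lambda>e. gen (Ghost e)) (rev es))"

lemma edges_simps [simp]:
  "edges [] = 1" "edges (e # es) = gen (Edge e) * edges es" "edges (es @ fs) = edges es * edges fs"
  by (simp_all add: edges_def)

lemma ghosts_simps [simp]: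
  "ghosts [] = 1" "ghosts (e # es) = ghosts es * gen (Ghost e)"
  "ghosts (es @ fs) = ghosts fs * ghosts es"
  by (simp_all add: ghosts_def)

context leavitt
begin

lemma vx_ed_orth: "e \<in> arcs G \<Longrightarrow> tail G e \<noteq> v \<Longrightarrow> vx v * ed e \<approx> 0"
proof -
  assume e: "e \<in> arcs G" and "tail G e \<noteq> v"
  have "vx v * ed e \<approx> vx v * vx (tail G e) * ed e"
    using cong_mult_left[OF cong_sym[OF tail_ed[OF e]], of "vx v"] by (simp add: mult.assoc)
  also have "vx v * vx (tail G e) * ed e \<approx> 0"
    using \<open>tail G e \<noteq> v\<close> vx_orth[of v "tail G e"] cong_0_mult by fastforce
  finally show ?thesis .
qed

lemma gh_vx_orth: "e \<in> arcs G \<Longrightarrow> tail G e \<noteq> v \<Longrightarrow> gh e * vx v \<approx> 0"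
proof -
  assume e: "e \<in> arcs G" and "tail G e \<noteq> v"
  have "gh e * vx v \<approx> gh e * (vx (tail G e) * vx v)"
    using cong_mult_right[OF cong_sym[OF gh_tail[OF e]], of "vx v"] by (simp add: mult.assoc)
  also have "gh e * (vx (tail G e) * vx v) \<approx> 0"
    using \<open>tail G e \<noteq> v\<close> vx_orth[of "tail G e" v] cong_0_mult by fastforce
  finally show ?thesis .
qed

lemma vx_gh_orth: "e \<in> arcs G \<Longrightarrow> head G e \<noteq> v \<Longrightarrow> vx v * gh e \<approx> 0"
proof -
  assume e: "e \<in> arcs G" and "head G e \<noteq> v"
  have "vx v * gh e \<approx> vx v * vx (head G e) * gh e"
    using cong_mult_left[OF cong_sym[OF head_gh[OF e]], of "vx v"] by (simp add: mult.assoc)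
  also have "vx v * vx (head G e) * gh e \<approx> 0"
    using \<open>head G e \<noteq> v\<close> vx_orth[of v "head G e"] cong_0_mult by fastforce
  finally show ?thesis .
qed

lemma ghosts_start: "awalk u es v \<Longrightarrow> vx v * ghosts es * vx u \<approx> vx v * ghosts es"
proof (cases es)
  case Nil
  then show "awalk u es v \<Longrightarrow> ?thesis" by (simp add: awalk_Nil_iff vx_idem)
next
  case (Cons e es')
  assume "awalk u es v"
  then have e: "e \<in> arcs G" "tail G e = u" using Cons by (auto simp: awalk_Cons_iff)
  show ?thesis
    using cong_mult_left[OF gh_tail[OF e(1)], of "vx v * ghosts es'"]
    by (simp add: Cons e mult.assoc)
qed

text \<open>The relation \<open>\<alpha>\<^sup>* \<alpha> = r(\<alpha>)\<close> for a path \<open>\<alpha>\<close>.\<close>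

lemma ghosts_edges_same: "awalk u es v \<Longrightarrow> vx v * ghosts es * edges es \<approx> vx v"
proof (induction es arbitrary: u)
  case (Cons e es)
  then have e: "e \<in> arcs G" and walk: "awalk (head G e) es v" by (auto simp: awalk_Cons_iff)
  have "vx v * ghosts (e # es) * edges (e # es)
      \<approx> vx v * ghosts es * vx (head G e) * edges es"
    using cong_mid[OF gh_ed[OF e], of "vx v * ghosts es" "edges es"] by (simp add: mult.assoc)
  also have "\<dots> \<approx> vx v * ghosts es * edges es"
    using ghosts_start[OF walk] by (rule cong_mult_right)
  also have "\<dots> \<approx> vx v" by (rule Cons.IH[OF walk])
  finally show ?case .
qed simp

lemma ghosts_edges_prefix:
  assumes "awalk u es v"
  shows "vx v * ghosts es * edges (es @ fs) \<approx> vx v * edges fs"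
  using cong_mult_right[OF ghosts_edges_same[OF assms], of "edges fs"] by (simp add: mult.assoc)

lemma ghosts_edges_extension:
  assumes "awalk u (es @ fs) v"
  shows "vx v * ghosts (es @ fs) * edges es \<approx> vx v * ghosts fs"
proof -
  obtain w where w: "awalk u es w" "awalk w fs v"
    using assms by (auto simp: awalk_append_iff)
  have "vx v * ghosts (es @ fs) * edges es \<approx> vx v * ghosts fs * vx w * (ghosts es * edges es)"
    using cong_mult_right[OF cong_sym[OF ghosts_start[OF w(2)]], of "ghosts es * edges es"]
    by (simp add: mult.assoc)
  also have "\<dots> \<approx> vx v * ghosts fs * vx w"
    using cong_mult_left[OF ghosts_edges_same[OF w(1)], of "vx v * ghosts fs"]
    by (simp add: mult.assoc)
  also have "\<dots> \<approx> vx v * ghosts fs" by (rule ghosts_start[OF w(2)])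
  finally show ?thesis .
qed

text \<open>
  \<open>\<alpha>\<^sup>* \<beta> = 0\<close> if neither of the lists \<open>\<alpha>\<close>, \<open>\<beta>\<close> extends the other; only \<open>\<alpha>\<close> has to be a path.
\<close>

lemma ghosts_edges_orth:
  assumes "awalk u es v" "set fs \<subseteq> arcs G"
    and "\<nexists>gs. fs = es @ gs" "\<nexists>gs. es = fs @ gs"
  shows "vx v * ghosts es * edges fs \<approx> 0"
  using assms
proof (induction es arbitrary: u fs)
  case (Cons e es)
  then obtain f fs' where fs: "fs = f # fs'" by (cases fs) auto
  have e: "e \<in> arcs G" and walk: "awalk (head G e) es v"
    using Cons.prems by (auto simp: awalk_Cons_iff)
  have f: "f \<in> arcs G" using Cons.prems fs by simp
  show ?case
  proof (cases "f = e")
    case False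
    have "vx v * ghosts es * (gh e * ed f) * edges fs' \<approx> 0"
      using gh_ed_orth[OF e f] False cong_0_mult by metis
    then show ?thesis by (simp add: fs mult.assoc)
  next
    case True
    have "vx v * ghosts (e # es) * edges fs \<approx> vx v * ghosts es * vx (head G e) * edges fs'"
      using cong_mid[OF gh_ed[OF e], of "vx v * ghosts es" "edges fs'"]
      by (simp add: fs True mult.assoc)
    also have "\<dots> \<approx> vx v * ghosts es * edges fs'"
      using ghosts_start[OF walk] by (rule cong_mult_right)
    also have "\<dots> \<approx> 0"
      by (rule Cons.IH[OF walk]) (use Cons.prems fs True in auto)
    finally show ?thesis .
  qed
qed simp


section \<open>Spanning monomials\<close>

text \<open>
  \<open>p\<close> is congruent to \<open>0\<close> or to some \<open>\<alpha> v \<beta>\<^sup>*\<close> with paths \<open>\<alpha>\<close> and \<open>\<beta>\<close> that end in the same vertex \<open>v\<close>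
  and have lengths that differ by \<open>n\<close>.
\<close>

definition monomial_of_degree :: "int \<Rightarrow> ('v, 'e, 'k) lpa_poly \<Rightarrow> bool" where
  "monomial_of_degree n p \<longleftrightarrow> p \<approx> 0 \<or>
     (\<exists>u es v fs w. awalk u es v \<and> awalk w fs v \<and>
        int (length es) - int (length fs) = n \<and> p \<approx> edges es * vx v * ghosts fs)"

lemma monomial_of_degreeI:
  "awalk u es v \<Longrightarrow> awalk w fs v \<Longrightarrow> int (length es) - int (length fs) = n \<Longrightarrow>
    p \<approx> edges es * vx v * ghosts fs \<Longrightarrow> monomial_of_degree n p"
  unfolding monomial_of_degree_def by blast

lemma monomial_of_degree_cong: "p \<approx> q \<Longrightarrow> monomial_of_degree n q \<Longrightarrow> monomial_of_degree n p"
proof -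
  assume pq: "p \<approx> q" and "monomial_of_degree n q"
  from this(2) show ?thesis
    unfolding monomial_of_degree_def[of n q]
  proof (elim disjE exE conjE)
    assume "q \<approx> 0"
    with pq have "p \<approx> 0" by (rule cong_trans)
    then show ?thesis by (simp add: monomial_of_degree_def)
  next
    fix u es v fs w
    assume *: "awalk u es v" "awalk w fs v" "int (length es) - int (length fs) = n"
      and "q \<approx> edges es * vx v * ghosts fs"
    from pq this(4) have "p \<approx> edges es * vx v * ghosts fs" by (rule cong_trans)
    with * show ?thesis by (rule monomial_of_degreeI)
  qed
qed

lemma monomial_mult_vertex:
  assumes "awalk w fs v" "awalk u es v" "int (length es) - int (length fs) = n"
  shows "monomial_of_degree n (edges es * vx v * ghosts fs * vx x)"
proof -
  have start: "edges es * vx v * ghosts fs * vx w \<approx> edges es * vx v * ghosts fs"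
    using cong_mult_left[OF ghosts_start[OF assms(1)], of "edges es"] by (simp add: mult.assoc)
  show ?thesis
  proof (cases "x = w")
    case True
    then show ?thesis using assms start by (auto intro: monomial_of_degreeI)
  next
    case False
    have "edges es * vx v * ghosts fs * vx x \<approx> edges es * vx v * ghosts fs * (vx w * vx x)"
      using cong_mult_right[OF cong_sym[OF start], of "vx x"] by (simp add: mult.assoc)
    also have "\<dots> \<approx> 0" using False vx_orth[of w x] cong_0_mult by metis
    finally show ?thesis by (simp add: monomial_of_degree_def)
  qed
qed

lemma monomial_mult_edge:
  assumes "awalk w fs v" "awalk u es v" "int (length es) - int (length fs) = n" "e \<in> arcs G"
  shows "monomial_of_degree (n + 1) (edges es * vx v * ghosts fs * ed e)"
proof (cases fs)
  case Nil
  show ?thesis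
  proof (cases "tail G e = v")
    case True
    have "edges es * vx v * ghosts fs * ed e \<approx> edges es * ed e"
      using cong_mult_left[OF tail_ed[OF assms(4)], of "edges es"]
      by (simp add: Nil True mult.assoc)
    also have "\<dots> \<approx> edges (es @ [e]) * vx (head G e) * ghosts []"
      using cong_mult_left[OF cong_sym[OF ed_head[OF assms(4)]], of "edges es"]
      by (simp add: mult.assoc)
    finally show ?thesis
      using assms Nil True
      by (intro monomial_of_degreeI[of u "es @ [e]" "head G e" "head G e" "[]"])
        (auto simp: awalk_append_iff awalk_Cons_iff awalk_Nil_iff)
  next
    case False
    have "edges es * (vx v * ed e) \<approx> 0"
      using vx_ed_orth[OF assms(4) False] cong_0_mult by metis
    then show ?thesis by (simp add: monomial_of_degree_def Nil mult.assoc)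
  qed
next
  case (Cons f fs')
  then have f: "f \<in> arcs G" and walk: "awalk (head G f) fs' v"
    using assms(1) by (auto simp: awalk_Cons_iff)
  show ?thesis
  proof (cases "e = f")
    case True
    have "edges es * vx v * ghosts fs * ed e \<approx> edges es * (vx v * ghosts fs' * vx (head G f))"
      using cong_mult_left[OF gh_ed[OF f], of "edges es * vx v * ghosts fs'"]
      by (simp add: Cons True mult.assoc)
    also have "\<dots> \<approx> edges es * (vx v * ghosts fs')"
      using ghosts_start[OF walk] by (rule cong_mult_left)
    finally show ?thesis
      using assms walk Cons
      by (intro monomial_of_degreeI[of u es v "head G f" fs']) (auto simp: mult.assoc)
  next
    case False
    have "edges es * vx v * ghosts fs' * (gh f * ed e) \<approx> 0"
      using gh_ed_orth[OF f assms(4)] False cong_0_mult by metis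
    then show ?thesis by (simp add: monomial_of_degree_def Cons mult.assoc)
  qed
qed

lemma monomial_mult_ghost:
  assumes "awalk w fs v" "awalk u es v" "int (length es) - int (length fs) = n" "e \<in> arcs G"
  shows "monomial_of_degree (n - 1) (edges es * vx v * ghosts fs * gh e)"
proof (cases "head G e = w")
  case True
  then show ?thesis
    using assms
    by (intro monomial_of_degreeI[of u es v "tail G e" "e # fs"])
      (auto simp: awalk_Cons_iff mult.assoc)
next
  case False
  have "edges es * vx v * ghosts fs * gh e \<approx> edges es * (vx v * ghosts fs * vx w) * gh e"
    using cong_mid[OF cong_sym[OF ghosts_start[OF assms(1)]], of "edges es" "gh e"]
    by (simp add: mult.assoc)
  also have "\<dots> = edges es * vx v * ghosts fs * (vx w * gh e)" by (simp add: mult.assoc)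
  also have "\<dots> \<approx> 0" using vx_gh_orth[OF assms(4) False] cong_0_mult by metis
  finally show ?thesis by (simp add: monomial_of_degree_def)
qed

lemma monomial_of_degree_mult_gen:
  assumes "monomial_of_degree n p" "x \<in> lpa_gens G"
  shows "monomial_of_degree (n + gen_degree x) (p * gen x)"
  using assms(1) unfolding monomial_of_degree_def[of n]
proof (elim disjE exE conjE)
  assume "p \<approx> 0"
  then show ?thesis by (simp add: monomial_of_degree_def cong_0_mult)
next
  fix u es v fs w
  assume walks: "awalk u es v" "awalk w fs v"
    and n: "int (length es) - int (length fs) = n" and p: "p \<approx> edges es * vx v * ghosts fs"
  have "monomial_of_degree (n + gen_degree x) (edges es * vx v * ghosts fs * gen x)"
    using assms(2)
      monomial_mult_vertex[OF walks(2) walks(1) n] monomial_mult_edge[OF walks(2) walks(1) n]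
      monomial_mult_ghost[OF walks(2) walks(1) n]
    by (cases x) (auto simp: lpa_gens_def)
  with cong_mult_right[OF p] show ?thesis by (rule monomial_of_degree_cong)
qed

lemma monomial_of_degree_gen:
  assumes "x \<in> lpa_gens G"
  shows "monomial_of_degree (gen_degree x) (gen x)"
proof -
  have "\<exists>u\<in>verts G. vx u * gen x \<approx> gen x"
  proof (cases x)
    case (Vertex v)
    then show ?thesis using assms vx_idem[of v] by (auto simp: lpa_gens_def)
  next
    case (Edge e)
    then show ?thesis
      using assms tail_ed[of e] by (auto simp: lpa_gens_def intro!: bexI[of _ "tail G e"])
  next
    case (Ghost e)
    then show ?thesis
      using assms head_gh[of e] by (auto simp: lpa_gens_def intro!: bexI[of _ "head G e"])
  qed
  then obtain u where u: "u \<in> verts G" "vx u * gen x \<approx> gen x" by blast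
  have "monomial_of_degree 0 (vx u)"
    using u(1) by (intro monomial_of_degreeI[of u "[]" u u "[]"]) (auto simp: awalk_Nil_iff)
  from monomial_of_degree_mult_gen[OF this assms] u(2) show ?thesis
    by (auto intro: monomial_of_degree_cong cong_sym)
qed

lemma monomial_of_degree_word:
  assumes "w \<noteq> 0" "over_gens G w"
  shows "monomial_of_degree (word_degree w) (Poly_Mapping.single w 1)"
proof -
  have "monomial_of_degree (word_degree (Word xs)) (Poly_Mapping.single (Word xs) 1)"
    if "xs \<noteq> []" "set xs \<subseteq> lpa_gens G" for xs
    using that
  proof (induction xs rule: rev_nonempty_induct)
    case (single x)
    then show ?case using monomial_of_degree_gen[of x] by (simp add: gen_def word_degree_def)
  next
    case (snoc x xs)
    then have "monomial_of_degree (word_degree (Word xs) + gen_degree x)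
        (Poly_Mapping.single (Word xs) 1 * gen x)"
      by (intro monomial_of_degree_mult_gen) auto
    then show ?case by (simp add: gen_def mult_single plus_word_def word_degree_def)
  qed
  from this[of "letters w"] assms show ?thesis by (simp add: over_gens_def)
qed

end


section \<open>Regularity by Gaussian elimination\<close>

text \<open>
  McCoy's lemma: if \<open>x - x a x\<close> is von Neumann regular, then so is \<open>x\<close>.
\<close>

lemma (in leavitt) regular_McCoy:
  assumes "x - x * a * x \<approx> x'" and "x' * b * x' \<approx> x'"
  shows "\<exists>y. x * y * x \<approx> x"
proof -
  let ?d = "x - x * a * x" and ?y = "a + (1 - a * x) * b * (1 - x * a)"
  have "?d * b * ?d \<approx> x' * b * x'"
    using assms(1) by (intro cong_mult cong_refl)
  also have "\<dots> \<approx> x'" by (rule assms(2))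
  also have "\<dots> \<approx> ?d" using assms(1) by (rule cong_sym)
  finally have "x * a * x + ?d * b * ?d \<approx> x * a * x + ?d"
    by (rule cong_add[OF cong_refl])
  moreover have "x * ?y * x = x * a * x + ?d * b * ?d"
    by (simp add: algebra_simps)
  ultimately have "x * ?y * x \<approx> x" by simp
  then show ?thesis by blast
qed

text \<open>
  Matrices over a field are von Neumann regular.  The products \<open>L i * R' j\<close> act as matrix units of a
  block diagonal matrix: row \<open>i\<close> lies in block \<open>\<kappa> i\<close>, column \<open>j\<close> in block \<open>\<tau> j\<close>, and \<open>L'\<close> and
  \<open>R\<close> serve as a left inverse of \<open>L\<close> and a right inverse of \<open>R'\<close>.  Linear independence of the matrix units is not
  needed.  Subtracting \<open>x a x\<close>, where \<open>a\<close> is the transposed matrix unit of a nonzero entry divided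
  by that entry, clears the row of the entry and creates no new nonzero row.
\<close>

lemma (in leavitt) regular_matrix:
  fixes L :: "'i \<Rightarrow> ('v, 'e, 'k) lpa_poly" and R' :: "'j \<Rightarrow> ('v, 'e, 'k) lpa_poly"
    and \<kappa> :: "'i \<Rightarrow> 'b" and \<tau> :: "'j \<Rightarrow> 'b"
  assumes fin: "finite I" "finite J"
    and right: "\<And>i j j'. i \<in> I \<Longrightarrow> j \<in> J \<Longrightarrow> j' \<in> J \<Longrightarrow> \<kappa> i = \<tau> j \<Longrightarrow>
      L i * R' j * R j' \<approx> (if j = j' then L i else 0)"
    and left: "\<And>i i' j. i \<in> I \<Longrightarrow> i' \<in> I \<Longrightarrow> j \<in> J \<Longrightarrow> \<kappa> i = \<tau> j \<Longrightarrow>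
      L' i' * (L i * R' j) \<approx> (if i = i' then R' j else 0)"
    and block: "\<And>i j. c i j \<noteq> 0 \<Longrightarrow> \<kappa> i = \<tau> j"
  shows "\<exists>y. (\<Sum>i\<in>I. \<Sum>j\<in>J. const (c i j) * (L i * R' j)) * y *
    (\<Sum>i\<in>I. \<Sum>j\<in>J. const (c i j) * (L i * R' j)) \<approx>
    (\<Sum>i\<in>I. \<Sum>j\<in>J. const (c i j) * (L i * R' j))"
  using block
proof (induction "card {i \<in> I. \<exists>j\<in>J. c i j \<noteq> 0}" arbitrary: c rule: less_induct)
  case less
  let ?x = "\<lambda>c. \<Sum>i\<in>I. \<Sum>j\<in>J. const (c i j) * (L i * R' j)"
  show ?case
  proof (cases "\<exists>i\<in>I. \<exists>j\<in>J. c i j \<noteq> 0")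
    case False
    then have "?x c = 0" by (intro sum.neutral ballI) auto
    then show ?thesis by simp
  next
    case True
    then obtain p q where pq: "p \<in> I" "q \<in> J" "c p q \<noteq> 0" by blast
    let ?a = "const (inverse (c p q)) * R q * L' p"
    let ?c' = "\<lambda>i j. c i j - c i q * inverse (c p q) * c p j"
    have xR: "?x c * R q \<approx> (\<Sum>i\<in>I. const (c i q) * L i)"
    proof -
      have "const (c i j) * (L i * R' j) * R q \<approx> (if j = q then const (c i q) * L i else 0)"
        if "i \<in> I" "j \<in> J" for i j
      proof (cases "c i j = 0")
        case False
        then have "\<kappa> i = \<tau> j" by (rule less.prems)
        from cong_mult_left[OF right[OF that pq(2) this], of "const (c i j)"] show ?thesis
          by (cases "j = q") (simp_all add: mult.assoc)
      qed auto
      then have "(\<Sum>i\<in>I. \<Sum>j\<in>J. const (c i j) * (L i * R' j) * R q)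
          \<approx> (\<Sum>i\<in>I. \<Sum>j\<in>J. if j = q then const (c i q) * L i else 0)"
        by (intro cong_sum)
      then show ?thesis using fin pq by (simp add: sum_distrib_right)
    qed
    have Lx: "L' p * ?x c \<approx> (\<Sum>j\<in>J. const (c p j) * R' j)"
    proof -
      have "L' p * (const (c i j) * (L i * R' j)) \<approx> (if i = p then const (c p j) * R' j else 0)"
        if "i \<in> I" "j \<in> J" for i j
      proof (cases "c i j = 0")
        case False
        then have "\<kappa> i = \<tau> j" by (rule less.prems)
        moreover have "L' p * (const (c i j) * (L i * R' j)) = const (c i j) * (L' p * (L i * R' j))"
          by (rule const_left_commute)
        ultimately show ?thesis
          using cong_mult_left[OF left[OF that(1) pq(1) that(2)], of "const (c i j)"]
          by (cases "i = p") simp_all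
      qed auto
      then have "(\<Sum>i\<in>I. \<Sum>j\<in>J. L' p * (const (c i j) * (L i * R' j)))
          \<approx> (\<Sum>i\<in>I. \<Sum>j\<in>J. if i = p then const (c p j) * R' j else 0)"
        by (intro cong_sum)
      also have "(\<Sum>i\<in>I. \<Sum>j\<in>J. if i = p then const (c p j) * R' j else 0)
          = (\<Sum>j\<in>J. const (c p j) * R' j)"
        using fin pq by (subst sum.swap) simp
      finally show ?thesis by (simp add: sum_distrib_left)
    qed
    have "?x c * ?a * ?x c = const (inverse (c p q)) * ((?x c * R q) * (L' p * ?x c))"
      using const_left_commute[of "?x c" "inverse (c p q)" "R q * (L' p * ?x c)"]
      by (simp only: mult.assoc)
    also have "\<dots> \<approx> const (inverse (c p q)) *
        ((\<Sum>i\<in>I. const (c i q) * L i) * (\<Sum>j\<in>J. const (c p j) * R' j))"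
      by (intro cong_mult_left cong_mult xR Lx)
    also have "\<dots> = (\<Sum>i\<in>I. \<Sum>j\<in>J. const (c i q * inverse (c p q) * c p j) * (L i * R' j))"
    proof -
      have "const (inverse (c p q)) * (const (c i q) * L i * (const (c p j) * R' j)) =
          const (c i q * inverse (c p q) * c p j) * (L i * R' j)" for i j
      proof -
        have "c i q * inverse (c p q) * c p j = inverse (c p q) * (c i q * c p j)" by simp
        then show ?thesis
          using const_left_commute[of "L i" "c p j" "R' j"]
          by (simp only: const_mult mult.assoc)
      qed
      then show ?thesis by (subst sum_product) (simp only: sum_distrib_left)
    qed
    finally have "?x c - ?x c * ?a * ?x c \<approx>
        ?x c - (\<Sum>i\<in>I. \<Sum>j\<in>J. const (c i q * inverse (c p q) * c p j) * (L i * R' j))"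
      by (rule cong_diff[OF cong_refl])
    also have "\<dots> = ?x ?c'"
      by (simp add: sum_subtractf const_diff left_diff_distrib)
    finally have reduce: "?x c - ?x c * ?a * ?x c \<approx> ?x ?c'" .
    have "p \<in> {i \<in> I. \<exists>j\<in>J. c i j \<noteq> 0} - {i \<in> I. \<exists>j\<in>J. ?c' i j \<noteq> 0}"
      using pq by auto
    moreover have "{i \<in> I. \<exists>j\<in>J. ?c' i j \<noteq> 0} \<subseteq> {i \<in> I. \<exists>j\<in>J. c i j \<noteq> 0}"
    proof
      fix i assume "i \<in> {i \<in> I. \<exists>j\<in>J. ?c' i j \<noteq> 0}"
      then obtain j where "i \<in> I" "j \<in> J" "?c' i j \<noteq> 0" by blast
      moreover from this have "c i j \<noteq> 0 \<or> c i q \<noteq> 0" by auto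
      ultimately show "i \<in> {i \<in> I. \<exists>j\<in>J. c i j \<noteq> 0}" using pq(2) by blast
    qed
    ultimately have "{i \<in> I. \<exists>j\<in>J. ?c' i j \<noteq> 0} \<subset> {i \<in> I. \<exists>j\<in>J. c i j \<noteq> 0}"
      by blast
    then have card: "card {i \<in> I. \<exists>j\<in>J. ?c' i j \<noteq> 0} < card {i \<in> I. \<exists>j\<in>J. c i j \<noteq> 0}"
      using fin by (intro psubset_card_mono) auto
    have "\<kappa> i = \<tau> j" if "?c' i j \<noteq> 0" for i j
    proof (cases "c i j = 0")
      case True
      then have "c i q \<noteq> 0" "c p j \<noteq> 0" using that by auto
      then show ?thesis using less.prems pq(3) by metis
    qed (rule less.prems)
    with card obtain b where "?x ?c' * b * ?x ?c' \<approx> ?x ?c'"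
      using less.hyps[of ?c'] by blast
    with reduce show ?thesis by (rule regular_McCoy)
  qed
qed


section \<open>Matrix units attached to a finite set of edges\<close>

text \<open>
  The paths with edges in a finite set \<open>F\<close> and range in a finite set \<open>V\<close> of vertices are cut off at
  the level \<open>m\<close>.  Nothing is assumed about the number of edges that a vertex emits.
\<close>

locale matrix_units = leavitt G K
  for G :: "('v, 'e) pre_digraph" and K :: "'k::field itself" +
  fixes F :: "'e set" and V :: "'v set" and m :: nat
  assumes fin: "finite F" "finite V"
    and F_arcs: "F \<subseteq> arcs G"
    and head_F: "head G ` F \<subseteq> V"
begin

text \<open>
  Below the top level \<open>m\<close>, the vertex \<open>v\<close> is replaced by the part of it that is orthogonal to all
  edges in \<open>F\<close>.  This separates a path from its proper extensions, which live on higher levels; on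
  level \<open>m\<close> there are no extensions to separate from.
\<close>

definition corner :: "'v \<Rightarrow> nat \<Rightarrow> ('v, 'e, 'k) lpa_poly" where
  "corner v l = (if l = m then vx v
     else vx v - (\<Sum>e | e \<in> F \<and> tail G e = v. ed e * gh e))"

lemma corner_vx: "corner v l * vx v \<approx> corner v l"
proof -
  have "(\<Sum>e | e \<in> F \<and> tail G e = v. ed e * gh e * vx v)
      \<approx> (\<Sum>e | e \<in> F \<and> tail G e = v. ed e * gh e)"
    using F_arcs gh_tail by (intro cong_sum) (auto simp: mult.assoc intro!: cong_mult_left)
  then show ?thesis
    by (auto simp: corner_def left_diff_distrib sum_distrib_right intro: cong_diff vx_idem)
qed

lemma vx_corner: "vx v * corner v l \<approx> corner v l"
proof -
  have "(\<Sum>e | e \<in> F \<and> tail G e = v. vx v * (ed e * gh e))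
      \<approx> (\<Sum>e | e \<in> F \<and> tail G e = v. ed e * gh e)"
    using F_arcs tail_ed
    by (intro cong_sum) (auto simp: mult.assoc[symmetric] intro!: cong_mult_right)
  then show ?thesis
    by (auto simp: corner_def right_diff_distrib sum_distrib_left intro: cong_diff vx_idem)
qed

lemma corner_ed:
  assumes "e \<in> F" "l \<noteq> m"
  shows "corner v l * ed e \<approx> 0"
proof -
  let ?d = "if tail G e = v then ed e else 0"
  have e: "e \<in> arcs G" using assms F_arcs by auto
  have "ed f * gh f * ed e \<approx> (if f = e then ed e else 0)" if "f \<in> F" for f
  proof (cases "f = e")
    case True
    have "ed e * (gh e * ed e) \<approx> ed e"
      using cong_trans[OF cong_mult_left[OF gh_ed[OF e]] ed_head[OF e]] .
    then show ?thesis by (simp add: True mult.assoc)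
  next
    case False
    have "ed f * (gh f * ed e) \<approx> 0"
      using gh_ed_orth[of f e] that False e F_arcs cong_0_mult(2) by blast
    then show ?thesis by (simp add: False mult.assoc)
  qed
  then have "(\<Sum>f | f \<in> F \<and> tail G f = v. ed f * gh f * ed e)
      \<approx> (\<Sum>f | f \<in> F \<and> tail G f = v. if f = e then ed e else 0)"
    by (intro cong_sum) auto
  also have "\<dots> = ?d" using fin assms by (simp add: sum.delta')
  finally have "(\<Sum>f | f \<in> F \<and> tail G f = v. ed f * gh f * ed e) \<approx> ?d" .
  moreover have "vx v * ed e \<approx> ?d"
    using tail_ed[OF e] vx_ed_orth[OF e] by auto
  ultimately have "vx v * ed e - (\<Sum>f | f \<in> F \<and> tail G f = v. ed f * gh f * ed e) \<approx> ?d - ?d"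
    by (intro cong_diff)
  then show ?thesis
    using assms(2) by (simp add: corner_def left_diff_distrib sum_distrib_right)
qed

lemma gh_corner:
  assumes "e \<in> F" "l \<noteq> m"
  shows "gh e * corner v l \<approx> 0"
proof -
  let ?d = "if tail G e = v then gh e else 0"
  have e: "e \<in> arcs G" using assms F_arcs by auto
  have "gh e * (ed f * gh f) \<approx> (if f = e then gh e else 0)" if "f \<in> F" for f
  proof (cases "f = e")
    case True
    have "gh e * ed e * gh e \<approx> gh e"
      using cong_trans[OF cong_mult_right[OF gh_ed[OF e]] head_gh[OF e]] .
    then show ?thesis by (simp add: True mult.assoc)
  next
    case False
    have "gh e * ed f * gh f \<approx> 0"
      using gh_ed_orth[of e f] that False e F_arcs cong_0_mult(1) by blast
    then show ?thesis by (simp add: False mult.assoc)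
  qed
  then have "(\<Sum>f | f \<in> F \<and> tail G f = v. gh e * (ed f * gh f))
      \<approx> (\<Sum>f | f \<in> F \<and> tail G f = v. if f = e then gh e else 0)"
    by (intro cong_sum) auto
  also have "\<dots> = ?d" using fin assms by (simp add: sum.delta')
  finally have "(\<Sum>f | f \<in> F \<and> tail G f = v. gh e * (ed f * gh f)) \<approx> ?d" .
  moreover have "gh e * vx v \<approx> ?d"
    using gh_tail[OF e] gh_vx_orth[OF e] by auto
  ultimately have "gh e * vx v - (\<Sum>f | f \<in> F \<and> tail G f = v. gh e * (ed f * gh f)) \<approx> ?d - ?d"
    by (intro cong_diff)
  then show ?thesis
    using assms(2) by (simp add: corner_def right_diff_distrib sum_distrib_left)
qed

lemma corner_idem: "corner v l * corner v l \<approx> corner v l"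
proof (cases "l = m")
  case True
  then show ?thesis by (simp add: corner_def vx_idem)
next
  case False
  have "corner v l * corner v l = corner v l * vx v -
      (\<Sum>e | e \<in> F \<and> tail G e = v. corner v l * (ed e * gh e))"
    using False by (simp add: corner_def[of v l] right_diff_distrib sum_distrib_left)
  moreover have "(\<Sum>e | e \<in> F \<and> tail G e = v. corner v l * (ed e * gh e))
      \<approx> (\<Sum>e | e \<in> F \<and> tail G e = v. 0)"
    using corner_ed[OF _ False, of _ v] cong_0_mult(1)
    by (intro cong_sum) (auto simp: mult.assoc[symmetric])
  ultimately show ?thesis using cong_diff[OF corner_vx[of v l]] by fastforce
qed

lemma corner_orth: "v \<noteq> v' \<Longrightarrow> corner v l * corner v' l' \<approx> 0"
proof -
  assume "v \<noteq> v'"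
  have "corner v l * corner v' l' \<approx> corner v l * vx v * (vx v' * corner v' l')"
    by (intro cong_mult cong_sym[OF corner_vx] cong_sym[OF vx_corner])
  also have "\<dots> = corner v l * (vx v * vx v') * corner v' l'" by (simp add: mult.assoc)
  also have "\<dots> \<approx> 0"
    using vx_orth[OF \<open>v \<noteq> v'\<close>] cong_0_mult by blast
  finally show ?thesis .
qed

text \<open>
  Paths \<open>\<alpha>\<close> with their range \<open>v\<close> and their level \<open>l\<close>, where level \<open>l\<close> means length \<open>l + a\<close>.  The
  rows of the matrices are indexed with one offset, the columns with another; an entry is allowed
  only between a row and a column of the same \<open>(v, l)\<close>, so its degree is the difference of the two
  offsets.
\<close>

definition indices :: "nat \<Rightarrow> ('e list \<times> 'v \<times> nat) set" where
  "indices a = {(es, v, l). set es \<subseteq> F \<and> v \<in> V \<and> l \<le> m \<and> length es = l + a \<and>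
     (\<exists>u. awalk u es v)}"

lemma finite_indices: "finite (indices a)"
proof (rule finite_subset)
  show "indices a \<subseteq> {es. set es \<subseteq> F \<and> length es \<le> m + a} \<times> V \<times> {..m}"
    by (auto simp: indices_def)
qed (use fin in \<open>auto intro: finite_lists_length_le\<close>)

text \<open>
  The column factor \<open>\<alpha> q\<close> and the row factor \<open>q \<alpha>\<^sup>*\<close> attached to an index, \<open>q\<close> being its corner; the
  matrix units are the products \<open>lft i * rgt j\<close>.
\<close>

fun lft :: "'e list \<times> 'v \<times> nat \<Rightarrow> ('v, 'e, 'k) lpa_poly" where
  "lft (es, v, l) = edges es * corner v l"

fun rgt :: "'e list \<times> 'v \<times> nat \<Rightarrow> ('v, 'e, 'k) lpa_poly" where
  "rgt (es, v, l) = corner v l * ghosts es"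

text \<open>
  If \<open>\<beta>\<close> properly extends \<open>\<alpha>\<close>, then \<open>\<alpha>\<close> has the lower level, so its corner kills the first edge of
  the remaining path; likewise with the roles exchanged.
\<close>

lemma rgt_lft:
  assumes "i \<in> indices a" "j \<in> indices a"
  shows "rgt i * lft j \<approx> (if i = j then corner (fst (snd i)) (snd (snd i)) else 0)"
proof -
  obtain es v l where i: "i = (es, v, l)" by (cases i)
  obtain es' v' l' where j: "j = (es', v', l')" by (cases j)
  obtain u u' where es: "awalk u es v" "set es \<subseteq> F" "l \<le> m" "length es = l + a"
    and es': "awalk u' es' v'" "set es' \<subseteq> F" "l' \<le> m" "length es' = l' + a"
    using assms by (auto simp: i j indices_def)
  \<comment> \<open>Insert \<open>v\<close> in order to apply the rules for \<open>\<alpha>\<^sup>* \<beta>\<close>.\<close>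
  have start: "rgt i * lft j \<approx> corner v l * (vx v * ghosts es * edges es') * corner v' l'"
    using cong_mult_right[OF cong_sym[OF corner_vx], of v l "ghosts es * edges es' * corner v' l'"]
    by (simp add: i j mult.assoc)
  consider "es = es'" | fs where "es' = es @ fs" "fs \<noteq> []" | fs where "es = es' @ fs" "fs \<noteq> []"
    | "\<nexists>fs. es' = es @ fs" "\<nexists>fs. es = es' @ fs"
    by (metis append_Nil2)
  then show ?thesis
  proof cases
    case 1
    have "corner v l * (vx v * ghosts es * edges es') * corner v' l' \<approx>
        corner v l * vx v * corner v' l'"
      using ghosts_edges_same[OF es(1)] unfolding 1[symmetric] by (rule cong_mid)
    also have "\<dots> \<approx> corner v l * corner v' l'" by (intro cong_mult_right corner_vx)
    also have "\<dots> \<approx> (if i = j then corner (fst (snd i)) (snd (snd i)) else 0)"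
      using 1 es(4) es'(4) corner_idem corner_orth by (auto simp: i j)
    finally show ?thesis by (rule cong_trans[OF start])
  next
    case 2
    then obtain f fs' where fs: "fs = f # fs'" by (cases fs) auto
    have f: "f \<in> F" "l \<noteq> m" using 2 es es' fs by auto
    have "corner v l * (vx v * ghosts es * edges es') * corner v' l' \<approx>
        corner v l * (vx v * edges fs) * corner v' l'"
      using ghosts_edges_prefix[OF es(1)] unfolding 2 by (rule cong_mid)
    also have "\<dots> = corner v l * vx v * (edges fs * corner v' l')" by (simp add: mult.assoc)
    also have "\<dots> \<approx> corner v l * (edges fs * corner v' l')" by (intro cong_mult_right corner_vx)
    also have "\<dots> = corner v l * ed f * (edges fs' * corner v' l')" by (simp add: fs mult.assoc)
    also have "\<dots> \<approx> 0" using corner_ed[OF f] cong_0_mult by blast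
    finally have "rgt i * lft j \<approx> 0" by (rule cong_trans[OF start])
    moreover have "i \<noteq> j" using 2 by (auto simp: i j)
    ultimately show ?thesis by simp
  next
    case 3
    then obtain f fs' where fs: "fs = f # fs'" by (cases fs) auto
    have f: "f \<in> F" "l' \<noteq> m" using 3 es es' fs by auto
    have "corner v l * (vx v * ghosts es * edges es') * corner v' l' \<approx>
        corner v l * (vx v * ghosts fs) * corner v' l'"
      using ghosts_edges_extension[of u es' fs v] es(1) unfolding 3 by (intro cong_mid)
    also have "\<dots> = corner v l * vx v * ghosts fs' * (gh f * corner v' l')"
      by (simp add: fs mult.assoc)
    also have "\<dots> \<approx> 0" using gh_corner[OF f] cong_0_mult by blast
    finally have "rgt i * lft j \<approx> 0" by (rule cong_trans[OF start])
    moreover have "i \<noteq> j" using 3 by (auto simp: i j)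
    ultimately show ?thesis by simp
  next
    case 4
    have "vx v * ghosts es * edges es' \<approx> 0"
      using 4 es es' F_arcs by (intro ghosts_edges_orth) auto
    then have "corner v l * (vx v * ghosts es * edges es') * corner v' l' \<approx> 0"
      using cong_0_mult by blast
    then have "rgt i * lft j \<approx> 0" by (rule cong_trans[OF start])
    moreover have "i \<noteq> j" using 4 by (auto simp: i j)
    ultimately show ?thesis by simp
  qed
qed

lemma lft_corner: "lft i * corner (fst (snd i)) (snd (snd i)) \<approx> lft i"
  by (cases i) (auto simp: mult.assoc intro: cong_mult_left corner_idem)

lemma corner_rgt: "corner (fst (snd i)) (snd (snd i)) * rgt i \<approx> rgt i"
  by (cases i) (auto simp: mult.assoc[symmetric] intro: cong_mult_right corner_idem)

text \<open>
  Congruent to a linear combination of the matrix units; the coefficients vanish between different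
  blocks.
\<close>

definition in_span :: "nat \<Rightarrow> nat \<Rightarrow> ('v, 'e, 'k) lpa_poly \<Rightarrow> bool" where
  "in_span a b p \<longleftrightarrow> (\<exists>c. (\<forall>i j. c i j \<noteq> 0 \<longrightarrow> snd i = snd j) \<and>
     p \<approx> (\<Sum>i\<in>indices a. \<Sum>j\<in>indices b. const (c i j) * (lft i * rgt j)))"

lemma in_span_regular:
  assumes "in_span a b p"
  shows "\<exists>y. p * y * p \<approx> p"
proof -
  obtain c where c: "\<And>i j. c i j \<noteq> 0 \<Longrightarrow> snd i = snd j"
    and p: "p \<approx> (\<Sum>i\<in>indices a. \<Sum>j\<in>indices b. const (c i j) * (lft i * rgt j))" (is "_ \<approx> ?x")
    using assms unfolding in_span_def by blast
  have "\<exists>y. ?x * y * ?x \<approx> ?x"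
  proof (rule regular_matrix[where \<kappa> = snd and \<tau> = snd and R = lft and L' = rgt])
    fix i j j' assume *: "i \<in> indices a" "j \<in> indices b" "j' \<in> indices b" "snd i = snd j"
    have "lft i * rgt j * lft j' \<approx>
        lft i * (if j = j' then corner (fst (snd j)) (snd (snd j)) else 0)"
      using cong_mult_left[OF rgt_lft[OF *(2,3)], of "lft i"] by (simp add: mult.assoc)
    also have "\<dots> \<approx> (if j = j' then lft i else 0)"
      using lft_corner[of i] *(4) by auto
    finally show "lft i * rgt j * lft j' \<approx> (if j = j' then lft i else 0)" .
  next
    fix i i' j assume *: "i \<in> indices a" "i' \<in> indices a" "j \<in> indices b" "snd i = snd j"
    have "rgt i' * (lft i * rgt j) \<approx>
        (if i' = i then corner (fst (snd i')) (snd (snd i')) else 0) * rgt j"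
      using cong_mult_right[OF rgt_lft[OF *(2,1)], of "rgt j"] by (simp add: mult.assoc)
    also have "\<dots> \<approx> (if i = i' then rgt j else 0)"
      using corner_rgt[of j] *(4) by auto
    finally show "rgt i' * (lft i * rgt j) \<approx> (if i = i' then rgt j else 0)" .
  qed (auto intro: finite_indices c)
  then obtain y where "?x * y * ?x \<approx> ?x" by blast
  then have "p * y * p \<approx> p"
    by (intro cong_trans[OF cong_mult[OF cong_mult_right[OF p, of y] p]] cong_trans[OF _ cong_sym[OF p]])
  then show ?thesis by blast
qed

lemma in_span_cong: "p \<approx> q \<Longrightarrow> in_span a b q \<Longrightarrow> in_span a b p"
  unfolding in_span_def using cong_trans[of p q] by blast

lemma in_span_zero: "in_span a b 0"
  unfolding in_span_def by (rule exI[of _ "\<lambda>_ _. 0"]) simp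

lemma in_span_add:
  assumes "in_span a b p" "in_span a b q"
  shows "in_span a b (p + q)"
proof -
  obtain c d where c: "\<And>i j. c i j \<noteq> 0 \<Longrightarrow> snd i = snd j" "\<And>i j. d i j \<noteq> 0 \<Longrightarrow> snd i = snd j"
    "p \<approx> (\<Sum>i\<in>indices a. \<Sum>j\<in>indices b. const (c i j) * (lft i * rgt j))"
    "q \<approx> (\<Sum>i\<in>indices a. \<Sum>j\<in>indices b. const (d i j) * (lft i * rgt j))"
    using assms unfolding in_span_def by blast
  have "snd i = snd j" if "c i j + d i j \<noteq> 0" for i j
    using c(1,2)[of i j] that by (metis add_0)
  moreover have "p + q \<approx>
      (\<Sum>i\<in>indices a. \<Sum>j\<in>indices b. const (c i j + d i j) * (lft i * rgt j))"
    using cong_add[OF c(3,4)] by (simp add: const_add distrib_right sum.distrib)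
  ultimately show ?thesis
    unfolding in_span_def by (intro exI[of _ "\<lambda>i j. c i j + d i j"]) blast
qed

lemma in_span_const_mult:
  assumes "in_span a b p"
  shows "in_span a b (const k * p)"
proof -
  obtain c where c: "\<And>i j. c i j \<noteq> 0 \<Longrightarrow> snd i = snd j"
    "p \<approx> (\<Sum>i\<in>indices a. \<Sum>j\<in>indices b. const (c i j) * (lft i * rgt j))"
    using assms unfolding in_span_def by blast
  have "const k * p \<approx> (\<Sum>i\<in>indices a. \<Sum>j\<in>indices b. const (k * c i j) * (lft i * rgt j))"
    using cong_mult_left[OF c(2), of "const k"]
    by (simp add: const_mult sum_distrib_left mult.assoc)
  then show ?thesis
    unfolding in_span_def using c(1) by (intro exI[of _ "\<lambda>i j. k * c i j"]) auto
qed

lemma in_span_sum: "(\<And>s. s \<in> S \<Longrightarrow> in_span a b (f s)) \<Longrightarrow> in_span a b (sum f S)"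
  by (induction S rule: infinite_finite_induct) (auto intro: in_span_zero in_span_add)

lemma in_span_unit:
  assumes "(es, v, l) \<in> indices a" "(fs, v, l) \<in> indices b"
  shows "in_span a b (edges es * corner v l * ghosts fs)"
proof -
  let ?c = "\<lambda>i j. if j = (fs, v, l) then if i = (es, v, l) then 1 else 0 else 0 :: 'k"
  have "const (?c i j) * (lft i * rgt j) =
      (if j = (fs, v, l) then if i = (es, v, l) then lft i * rgt j else 0 else 0)" for i j
    by simp
  then have "(\<Sum>i\<in>indices a. \<Sum>j\<in>indices b. const (?c i j) * (lft i * rgt j)) =
      lft (es, v, l) * rgt (fs, v, l)"
    using assms finite_indices by (simp only: sum.delta) simp
  moreover have "edges es * corner v l * ghosts fs \<approx> lft (es, v, l) * rgt (fs, v, l)"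
    using cong_mid[OF cong_sym[OF corner_idem], of "edges es" v l "ghosts fs"]
    by (simp add: mult.assoc)
  ultimately show ?thesis
    unfolding in_span_def by (intro exI[of _ ?c]) auto
qed

text \<open>
  Below the top level, \<open>v\<close> is its corner plus the sum of \<open>e e\<^sup>*\<close> over the edges \<open>e \<in> F\<close> with source
  \<open>v\<close>.  Hence \<open>\<alpha> v \<beta>\<^sup>*\<close> is a matrix unit plus the sum of the monomials \<open>(\<alpha> e) (\<beta> e)\<^sup>*\<close>, which are one
  level higher.
\<close>

lemma in_span_monomial:
  assumes "l \<le> m" "set es \<subseteq> F" "set fs \<subseteq> F" "v \<in> V" "length es = l + a" "length fs = l + b"
    "awalk u es v" "awalk w fs v"
  shows "in_span a b (edges es * vx v * ghosts fs)"
  using assms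
proof (induction l arbitrary: es fs v rule: inc_induct)
  case base
  then have "in_span a b (edges es * corner v m * ghosts fs)"
    by (intro in_span_unit) (auto simp: indices_def)
  then show ?case by (simp add: corner_def)
next
  case (step l)
  let ?S = "{e \<in> F. tail G e = v}"
  have "in_span a b (edges es * corner v l * ghosts fs)"
    using step by (intro in_span_unit) (auto simp: indices_def)
  moreover have "in_span a b (\<Sum>e\<in>?S. edges es * (ed e * gh e) * ghosts fs)"
  proof (rule in_span_sum)
    fix e assume e: "e \<in> ?S"
    then have arc: "e \<in> arcs G" using F_arcs by auto
    have "edges es * (ed e * gh e) * ghosts fs \<approx> edges es * (ed e * vx (head G e) * gh e) * ghosts fs"
      by (intro cong_mid cong_mult_right cong_sym[OF ed_head[OF arc]])
    then have "edges es * (ed e * gh e) * ghosts fs \<approx>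
        edges (es @ [e]) * vx (head G e) * ghosts (fs @ [e])"
      by (simp add: mult.assoc)
    moreover have "in_span a b (edges (es @ [e]) * vx (head G e) * ghosts (fs @ [e]))"
      using e arc head_F step.prems
      by (intro step.IH) (auto simp: awalk_append_iff awalk_Cons_iff awalk_Nil_iff)
    ultimately show "in_span a b (edges es * (ed e * gh e) * ghosts fs)" by (rule in_span_cong)
  qed
  ultimately have "in_span a b (edges es * corner v l * ghosts fs +
      (\<Sum>e\<in>?S. edges es * (ed e * gh e) * ghosts fs))" by (rule in_span_add)
  moreover have "edges es * corner v l * ghosts fs + (\<Sum>e\<in>?S. edges es * (ed e * gh e) * ghosts fs)
      = edges es * vx v * ghosts fs"
    using step.hyps
    by (simp add: corner_def right_diff_distrib left_diff_distrib sum_distrib_left sum_distrib_right)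
  ultimately show ?case by simp
qed

end

lemma (in leavitt) homogeneous_regular:
  fixes x :: "('v, 'e, 'k) lpa_poly"
  assumes "x \<in> free_component G n"
  shows "\<exists>y. x * y * x \<approx> x"
proof -
  let ?W = "{w \<in> Poly_Mapping.keys x. \<not> Poly_Mapping.single w 1 \<approx> 0}"
  have "\<exists>t. case t of (es, v, fs) \<Rightarrow> (\<exists>u. awalk u es v) \<and> (\<exists>u. awalk u fs v) \<and>
      int (length es) - int (length fs) = n \<and>
      Poly_Mapping.single w 1 \<approx> edges es * vx v * ghosts fs" if w: "w \<in> ?W" for w
  proof -
    have "w \<noteq> 0" "over_gens G w" "word_degree w = n"
      using w assms by (auto simp: free_component_def free_carrier_iff)
    then have "monomial_of_degree n (Poly_Mapping.single w 1)"
      using monomial_of_degree_word by blast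
    then obtain u es v fs u' where "awalk u es v" "awalk u' fs v"
      "int (length es) - int (length fs) = n"
      "Poly_Mapping.single w 1 \<approx> edges es * vx v * ghosts fs"
      using w unfolding monomial_of_degree_def by blast
    then show ?thesis by (intro exI[of _ "(es, v, fs)"]) auto
  qed
  then have "\<forall>w\<in>?W. \<exists>t. case t of (es, v, fs) \<Rightarrow> (\<exists>u. awalk u es v) \<and> (\<exists>u. awalk u fs v) \<and>
      int (length es) - int (length fs) = n \<and>
      Poly_Mapping.single w 1 \<approx> edges es * vx v * ghosts fs" by (rule ballI)
  from bchoice[OF this] obtain t where t: "\<forall>w\<in>?W. case t w of (es, v, fs) \<Rightarrow> (\<exists>u. awalk u es v) \<and>
      (\<exists>u. awalk u fs v) \<and> int (length es) - int (length fs) = n \<and>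
      Poly_Mapping.single w 1 \<approx> edges es * vx v * ghosts fs"
    by (rule exE)
  define es v fs where "es w = fst (t w)" and "v w = fst (snd (t w))" and "fs w = snd (snd (t w))"
    for w
  have W: "\<exists>u. awalk u (es w) (v w)" "\<exists>u. awalk u (fs w) (v w)"
    "int (length (es w)) - int (length (fs w)) = n"
    "Poly_Mapping.single w 1 \<approx> edges (es w) * vx (v w) * ghosts (fs w)" if "w \<in> ?W" for w
    using bspec[OF t that] by (auto simp: es_def v_def fs_def split: prod.splits)
  \<comment> \<open>\<open>m\<close> is only an upper bound for the lengths of all these paths.\<close>
  define F where "F = (\<Union>w\<in>?W. set (es w) \<union> set (fs w))"
  define V where "V = v ` ?W \<union> head G ` F"
  define m where "m = (\<Sum>w\<in>?W. length (es w))"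
  have finW: "finite ?W" by simp
  interpret matrix_units G K F V m
  proof
    show "finite F" unfolding F_def by (rule finite_UN_I[OF finW]) simp
    then show "finite V" unfolding V_def using finW by blast
    show "F \<subseteq> arcs G"
      unfolding F_def
    proof (intro UN_least Un_least)
      fix w assume "w \<in> ?W"
      from W(1,2)[OF this] show "set (es w) \<subseteq> arcs G" "set (fs w) \<subseteq> arcs G"
        by (auto simp: awalk_def)
    qed
    show "head G ` F \<subseteq> V" by (auto simp: V_def)
  qed
  have "in_span (nat n) (nat (- n)) (Poly_Mapping.single w 1)" if "w \<in> Poly_Mapping.keys x" for w
  proof (cases "Poly_Mapping.single w 1 \<approx> 0")
    case True
    then show ?thesis using in_span_zero by (rule in_span_cong)
  next
    case False
    with that have w: "w \<in> ?W" by simp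
    obtain u u' where walks: "awalk u (es w) (v w)" "awalk u' (fs w) (v w)"
      using W(1,2)[OF w] by blast
    \<comment> \<open>The offsets \<open>nat n\<close> and \<open>nat (- n)\<close> differ by \<open>n\<close>, and one of them is \<open>0\<close>.\<close>
    let ?l = "min (length (es w)) (length (fs w))"
    have "length (es w) \<le> m"
      unfolding m_def using w finW by (intro member_le_sum) auto
    then have "in_span (nat n) (nat (- n)) (edges (es w) * vx (v w) * ghosts (fs w))"
      using w W(3)[OF w] walks
      by (intro in_span_monomial[of ?l _ _ _ _ _ u u']) (auto simp: F_def V_def)
    with W(4)[OF w] show ?thesis by (rule in_span_cong)
  qed
  then have "in_span (nat n) (nat (- n)) (\<Sum>w\<in>Poly_Mapping.keys x.
      const (Poly_Mapping.lookup x w) * Poly_Mapping.single w 1)"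
    by (intro in_span_sum in_span_const_mult)
  also have "(\<Sum>w\<in>Poly_Mapping.keys x. const (Poly_Mapping.lookup x w) * Poly_Mapping.single w 1) = x"
    by (simp add: const_def mult_single sum_monomials)
  finally show ?thesis by (rule in_span_regular)
qed


section \<open>The grading\<close>

text \<open>The homogeneous component of degree \<open>n\<close> of a polynomial.\<close>

abbreviation component :: "int \<Rightarrow> ('v, 'e, 'k::field) lpa_poly \<Rightarrow> ('v, 'e, 'k) lpa_poly" where
  "component n \<equiv> restr (\<lambda>w. word_degree w = n)"

lemma free_component_zero: "0 \<in> free_component G n"
  by (simp add: free_component_def free_carrier_zero)

lemma free_component_add:
  "p \<in> free_component G n \<Longrightarrow> q \<in> free_component G n \<Longrightarrow> p + q \<in> free_component G n"
  using keys_add[of p q] by (auto simp: free_component_def free_carrier_add)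

lemma free_component_diff:
  assumes "p \<in> free_component G n" "q \<in> free_component G n"
  shows "p - q \<in> free_component G n"
proof -
  have "Poly_Mapping.keys (p - q) \<subseteq> Poly_Mapping.keys p \<union> Poly_Mapping.keys q"
    by (auto simp: in_keys_iff lookup_minus)
  then show ?thesis using assms by (auto simp: free_component_def free_carrier_diff)
qed

lemma free_component_sum:
  "(\<And>i. i \<in> A \<Longrightarrow> f i \<in> free_component G n) \<Longrightarrow> sum f A \<in> free_component G n"
  by (induction A rule: infinite_finite_induct)
    (auto intro: free_component_zero free_component_add)

lemma free_component_mult:
  assumes "p \<in> free_component G m" "q \<in> free_component G n"
  shows "p * q \<in> free_component G (m + n)"
  using assms keys_mult[of p q] by (fastforce simp: free_component_def intro: free_carrier_mult)

lemma gen_free_component: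
  "x \<in> lpa_gens G \<Longrightarrow> gen_degree x = n \<Longrightarrow> gen x \<in> free_component G n"
  using gen_free_carrier[of x G] by (auto simp: free_component_def gen_def word_degree_def)

lemma component_free_component: "p \<in> free_component G m \<Longrightarrow> component n p = (if n = m then p else 0)"
  by (auto simp: free_component_def intro!: restr_id restr_none)

lemma component_in: "p \<in> free_carrier G \<Longrightarrow> component n p \<in> free_component G n"
  by (auto simp: free_component_def free_carrier_iff keys_restr)

lemma sum_components: "(\<Sum>n\<in>word_degree ` Poly_Mapping.keys p. component n p) = p"
  by (rule poly_mapping_eqI) (auto simp: lookup_sum lookup_restr in_keys_iff sum.delta')

lemma component_monomial_mult:
  "component n (Poly_Mapping.single w c * p) = Poly_Mapping.single w c * component (n - word_degree w) p"
  by (induction p rule: monomial_induct)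
    (auto simp: mult_single restr_single restr_add distrib_left)

lemma component_mult_monomial:
  "component n (p * Poly_Mapping.single w c) = component (n - word_degree w) p * Poly_Mapping.single w c"
  by (induction p rule: monomial_induct)
    (auto simp: mult_single restr_single restr_add distrib_right)

context leavitt
begin

lemma relator_homogeneous:
  fixes p :: "('v, 'e, 'k) lpa_poly"
  assumes "p \<in> lpa_relators G"
  shows "\<exists>n. p \<in> free_component G n"
proof -
  have vx: "vx v \<in> free_component G 0" if "v \<in> verts G" for v
    using that by (intro gen_free_component) (auto simp: lpa_gens_def)
  have ed: "ed e \<in> free_component G 1" and gh: "gh e \<in> free_component G (-1)"
    if "e \<in> arcs G" for e
    using that by (auto intro!: gen_free_component simp: lpa_gens_def)
  from assms show ?thesis
  proof cases
    case (vertices v w)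
    then show ?thesis
      using free_component_mult[OF vx vx, of v w]
      by (intro exI[of _ 0]) (auto intro!: free_component_diff free_component_zero vx)
  next
    case (source_edge e)
    then show ?thesis
      using free_component_mult[OF vx ed, of "tail G e" e]
      by (intro exI[of _ 1]) (auto intro!: free_component_diff ed)
  next
    case (edge_range e)
    then show ?thesis
      using free_component_mult[OF ed vx, of e "head G e"]
      by (intro exI[of _ 1]) (auto intro!: free_component_diff ed)
  next
    case (range_ghost e)
    then show ?thesis
      using free_component_mult[OF vx gh, of "head G e" e]
      by (intro exI[of _ "-1"]) (auto intro!: free_component_diff gh)
  next
    case (ghost_source e)
    then show ?thesis
      using free_component_mult[OF gh vx, of e "tail G e"]
      by (intro exI[of _ "-1"]) (auto intro!: free_component_diff gh)
  next
    case (ghost_edge e f)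
    then show ?thesis
      using free_component_mult[OF gh ed, of e f]
      by (intro exI[of _ 0]) (auto intro!: free_component_diff free_component_zero vx)
  next
    case (regular v)
    have "ed e * gh e \<in> free_component G 0" if "e \<in> out_arcs G v" for e
      using free_component_mult[OF ed gh, of e e] that by simp
    then show ?thesis
      using regular
      by (intro exI[of _ 0])
        (auto intro!: free_component_diff free_component_sum vx simp: regular_vertex_def)
  qed
qed

text \<open>The ideal is graded, because it is generated by homogeneous elements.\<close>

lemma component_ideal:
  fixes p :: "('v, 'e, 'k) lpa_poly"
  assumes "p \<in> lpa_ideal G"
  shows "component n p \<in> lpa_ideal G"
  using assms
proof (induction arbitrary: n rule: lpa_ideal.induct)
  case (relator p)
  then obtain m where "p \<in> free_component G m" using relator_homogeneous by blast
  then show ?case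
    using relator by (auto simp: component_free_component intro: lpa_ideal.relator lpa_ideal.zero)
next
  case zero
  then show ?case by (simp add: lpa_ideal.zero)
next
  case (add p q)
  then show ?case by (simp add: restr_add lpa_ideal.add)
next
  case (scalar p c)
  then show ?case
    using lpa_ideal.scalar[OF scalar.IH[of n], of c]
    by (simp add: scale_eq_mult component_monomial_mult)
next
  case (left a p)
  have a: "Poly_Mapping.single w (Poly_Mapping.lookup a w) \<in> free_carrier G"
    if "w \<in> Poly_Mapping.keys a" for w
    using left(1) that by (auto simp: free_carrier_iff split: if_splits)
  show ?case
    by (induction a rule: monomial_induct)
      (auto simp: distrib_right restr_add component_monomial_mult
        intro: lpa_ideal.intros a left.IH)
next
  case (right p a)
  have a: "Poly_Mapping.single w (Poly_Mapping.lookup a w) \<in> free_carrier G"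
    if "w \<in> Poly_Mapping.keys a" for w
    using right(2) that by (auto simp: free_carrier_iff split: if_splits)
  show ?case
    by (induction a rule: monomial_induct)
      (auto simp: distrib_left restr_add component_mult_monomial
        intro: lpa_ideal.intros a right.IH)
qed


section \<open>The quotient algebra\<close>

abbreviation coset :: "('v, 'e, 'k) lpa_poly \<Rightarrow> ('v, 'e, 'k) lpa_poly set" where
  "coset p \<equiv> lpa_ideal G +>\<^bsub>free_algebra G\<^esub> p"

abbreviation LPA :: "('v, 'e, 'k) lpa_poly set ring" where
  "LPA \<equiv> leavitt_path_algebra G"

lemma mem_coset: "x \<in> coset p \<longleftrightarrow> x - p \<in> lpa_ideal G"
  by (auto simp: a_r_coset_def' free_algebra_def) (metis diff_add_cancel)

lemma coset_eq_iff: "coset p = coset q \<longleftrightarrow> p - q \<in> lpa_ideal G"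
proof
  assume "coset p = coset q"
  moreover have "p \<in> coset p" by (simp add: mem_coset lpa_ideal.zero)
  ultimately show "p - q \<in> lpa_ideal G" by (simp add: mem_coset)
next
  assume pq: "p - q \<in> lpa_ideal G"
  show "coset p = coset q"
  proof (intro Set.set_eqI iffI)
    fix x assume "x \<in> coset p"
    then show "x \<in> coset q" using lpa_ideal.add[OF pq, of "x - p"] by (simp add: mem_coset)
  next
    fix x assume "x \<in> coset q"
    then show "x \<in> coset p" using lpa_ideal_diff[OF _ pq, of "x - q"] by (simp add: mem_coset)
  qed
qed

lemma carrier_LPA: "carrier LPA = coset ` free_carrier G"
  by (auto simp: leavitt_path_algebra_def FactRing_def A_RCOSETS_def' free_algebra_def)

lemma zero_LPA: "\<zero>\<^bsub>LPA\<^esub> = coset 0"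
  by (auto simp: leavitt_path_algebra_def FactRing_def mem_coset)

lemma add_LPA: "coset p \<oplus>\<^bsub>LPA\<^esub> coset q = coset (p + q)"
proof -
  have "x \<in> coset p <+>\<^bsub>free_algebra G\<^esub> coset q \<longleftrightarrow> x \<in> coset (p + q)" for x
  proof
    assume "x \<in> coset p <+>\<^bsub>free_algebra G\<^esub> coset q"
    then obtain a b where "a - p \<in> lpa_ideal G" "b - q \<in> lpa_ideal G" "x = a + b"
      by (auto simp: set_add_def' free_algebra_def mem_coset[unfolded free_algebra_def])
    then show "x \<in> coset (p + q)"
      using lpa_ideal.add[of "a - p" G "b - q"] by (simp add: mem_coset algebra_simps)
  next
    assume "x \<in> coset (p + q)"
    then have "x - q \<in> coset p" "q \<in> coset q"
      by (simp_all add: mem_coset algebra_simps lpa_ideal.zero)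
    moreover have "x = (x - q) \<oplus>\<^bsub>free_algebra G\<^esub> q" by (simp add: free_algebra_def)
    ultimately show "x \<in> coset p <+>\<^bsub>free_algebra G\<^esub> coset q"
      unfolding set_add_def' by blast
  qed
  then show ?thesis by (auto simp: leavitt_path_algebra_def FactRing_def)
qed

lemma mult_LPA:
  assumes "p \<in> free_carrier G" "q \<in> free_carrier G"
  shows "coset p \<otimes>\<^bsub>LPA\<^esub> coset q = coset (p * q)"
proof -
  have "coset (a * b) = coset (p * q)" if "a \<in> coset p" "b \<in> coset q" for a b
  proof -
    have ideal: "a - p \<in> lpa_ideal G" "b - q \<in> lpa_ideal G" using that by (auto simp: mem_coset)
    have "b \<in> free_carrier G"
      using free_carrier_add[OF lpa_ideal_free_carrier[OF ideal(2)] assms(2)] by simp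
    then have "(a - p) * b + p * (b - q) \<in> lpa_ideal G"
      using ideal assms by (intro lpa_ideal.add[OF lpa_ideal.right lpa_ideal.left])
    then show ?thesis by (simp add: coset_eq_iff algebra_simps)
  qed
  moreover have "p \<in> coset p" "q \<in> coset q" by (simp_all add: mem_coset lpa_ideal.zero)
  moreover have "coset p \<otimes>\<^bsub>LPA\<^esub> coset q = (\<Union>a\<in>coset p. \<Union>b\<in>coset q. coset (a * b))"
    by (simp add: leavitt_path_algebra_def FactRing_def rcoset_mult_def)
      (simp add: free_algebra_def)
  ultimately show ?thesis by blast
qed

lemma abelian_group_LPA: "abelian_group LPA"
proof (rule abelian_groupI)
  fix x :: "('v, 'e, 'k) lpa_poly set" assume "x \<in> carrier LPA"
  then obtain p where p: "p \<in> free_carrier G" "x = coset p" by (auto simp: carrier_LPA)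
  then show "\<exists>y\<in>carrier LPA. y \<oplus>\<^bsub>LPA\<^esub> x = \<zero>\<^bsub>LPA\<^esub>"
    by (auto simp: carrier_LPA add_LPA zero_LPA intro!: bexI[of _ "- p"] free_carrier_uminus)
qed (auto simp: carrier_LPA add_LPA zero_LPA add_ac free_carrier_add free_carrier_zero)

lemma nonunital_ring_LPA: "nonunital_ring LPA"
  by (intro nonunital_ring.intro nonunital_ring_axioms.intro abelian_group_LPA)
    (auto simp: carrier_LPA add_LPA mult_LPA free_carrier_add free_carrier_mult mult.assoc
      distrib_left distrib_right)

lemma finsum_LPA:
  assumes "finite S" "\<And>s. s \<in> S \<Longrightarrow> f s \<in> free_carrier G"
  shows "(\<Oplus>\<^bsub>LPA\<^esub>s\<in>S. coset (f s)) = coset (sum f S)"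
proof -
  interpret abelian_group LPA by (rule abelian_group_LPA)
  show ?thesis
    using assms
  proof (induction S)
    case (insert s S)
    then have "(\<Oplus>\<^bsub>LPA\<^esub>s\<in>insert s S. coset (f s)) =
        coset (f s) \<oplus>\<^bsub>LPA\<^esub> (\<Oplus>\<^bsub>LPA\<^esub>s\<in>S. coset (f s))"
      by (intro finsum_insert) (auto simp: carrier_LPA)
    then show ?case using insert by (simp add: add_LPA)
  qed (simp add: zero_LPA)
qed

lemma additive_subgroup_component: "additive_subgroup (lpa_component G n) LPA"
proof -
  interpret abelian_group LPA by (rule abelian_group_LPA)
  have sub: "free_component G n \<subseteq> (free_carrier G :: ('v, 'e, 'k) lpa_poly set)"
    by (auto simp: free_component_def)
  show ?thesis
  proof (rule additive_subgroupI, rule subgroup.intro)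
    fix x :: "('v, 'e, 'k) lpa_poly set" assume "x \<in> lpa_component G n"
    then obtain p where p: "p \<in> free_component G n" "x = coset p"
      by (auto simp: lpa_component_def)
    have np: "- p \<in> free_component G n"
      using free_component_diff[OF free_component_zero p(1)] by simp
    have "\<ominus>\<^bsub>LPA\<^esub> x = coset (- p)"
      using p np sub by (intro minus_equality) (auto simp: carrier_LPA add_LPA zero_LPA)
    then show "inv\<^bsub>add_monoid LPA\<^esub> x \<in> lpa_component G n"
      using np by (auto simp: a_inv_def lpa_component_def)
  qed (use sub in \<open>auto simp: lpa_component_def carrier_LPA add_LPA zero_LPA
      intro!: free_component_add free_component_zero\<close>)
qed

text \<open>
  The component of degree \<open>n\<close> is well defined on cosets, because the ideal is graded; hence the
  summands of a homogeneous decomposition are determined.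
\<close>

lemma coset_component_unique:
  assumes p: "p \<in> free_carrier G" and f: "\<And>n. f n \<in> lpa_component G n"
    and fin: "finite {n. f n \<noteq> \<zero>\<^bsub>LPA\<^esub>}"
    and sum: "coset p = (\<Oplus>\<^bsub>LPA\<^esub>n\<in>{n. f n \<noteq> \<zero>\<^bsub>LPA\<^esub>}. f n)"
  shows "f n = coset (component n p)"
proof -
  let ?S = "{n. f n \<noteq> \<zero>\<^bsub>LPA\<^esub>}"
  have "\<forall>n. \<exists>r. r \<in> free_component G n \<and> f n = coset r"
    using f by (auto simp: lpa_component_def)
  then obtain r where r: "\<And>n. r n \<in> free_component G n" "\<And>n. f n = coset (r n)"
    by metis
  have "coset p = coset (\<Sum>n\<in>?S. r n)"
    using finsum_LPA[OF fin, of r] r sum by (simp add: free_component_def)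
  then have "p - (\<Sum>n\<in>?S. r n) \<in> lpa_ideal G" by (simp add: coset_eq_iff)
  then have "component n (p - (\<Sum>n\<in>?S. r n)) \<in> lpa_ideal G" by (rule component_ideal)
  moreover have "component n (r k) = (if k = n then r n else 0)" for k
    using component_free_component[OF r(1)[of k], of n] by auto
  then have "component n (\<Sum>n\<in>?S. r n) = (if n \<in> ?S then r n else 0)"
    unfolding restr_sum using fin by (simp only: sum.delta)
  ultimately have "coset (component n p) = coset (if n \<in> ?S then r n else 0)"
    by (simp add: restr_diff coset_eq_iff)
  then show ?thesis using r(2)[of n] by (auto simp: zero_LPA)
qed

lemma graded_ring_LPA: "graded_ring LPA (lpa_component G)"
proof (intro graded_ring.intro graded_ring_axioms.intro nonunital_ring_LPA
    additive_subgroup_component)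
  fix x y :: "('v, 'e, 'k) lpa_poly set" and m n
  assume "x \<in> lpa_component G m" "y \<in> lpa_component G n"
  then show "x \<otimes>\<^bsub>LPA\<^esub> y \<in> lpa_component G (m + n)"
  proof -
    obtain p q where "p \<in> free_component G m" "x = coset p" "q \<in> free_component G n" "y = coset q"
      using \<open>x \<in> _\<close> \<open>y \<in> _\<close> unfolding lpa_component_def by blast
    moreover from this have "p \<in> free_carrier G" "q \<in> free_carrier G"
      by (simp_all add: free_component_def)
    ultimately show ?thesis
      unfolding lpa_component_def by (simp add: mult_LPA free_component_mult)
  qed
next
  fix x :: "('v, 'e, 'k) lpa_poly set" assume "x \<in> carrier LPA"
  then obtain p where p: "p \<in> free_carrier G" "x = coset p" by (auto simp: carrier_LPA)
  let ?f = "\<lambda>n. coset (component n p)" and ?D = "word_degree ` Poly_Mapping.keys p"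
  let ?S = "{n. ?f n \<noteq> \<zero>\<^bsub>LPA\<^esub>}"
  have "component n p = 0" if "n \<notin> ?D" for n
    using that by (intro restr_none) auto
  then have SD: "?S \<subseteq> ?D" by (auto simp: zero_LPA)
  then have finS: "finite ?S" by (rule finite_subset) simp
  have "component n p \<in> free_carrier G" for n
    using component_in[OF p(1), of n] by (simp add: free_component_def)
  then have "(\<Oplus>\<^bsub>LPA\<^esub>n\<in>?S. ?f n) = coset (\<Sum>n\<in>?S. component n p)"
    by (rule finsum_LPA[OF finS])
  \<comment> \<open>The components outside \<open>?S\<close> lie in the ideal, though they need not vanish.\<close>
  also have "\<dots> = coset p"
  proof -
    have "(\<Sum>n\<in>?D - ?S. component n p) \<in> lpa_ideal G"
      by (intro lpa_ideal_sum) (auto simp: zero_LPA coset_eq_iff)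
    moreover have "(\<Sum>n\<in>?D - ?S. component n p) = p - (\<Sum>n\<in>?S. component n p)"
      using SD by (subst sum_diff) (auto simp: sum_components)
    ultimately have "coset p = coset (\<Sum>n\<in>?S. component n p)" by (simp add: coset_eq_iff)
    then show ?thesis by simp
  qed
  finally have sum: "x = (\<Oplus>\<^bsub>LPA\<^esub>n\<in>?S. ?f n)" using p by simp
  show "\<exists>!f. (\<forall>n. f n \<in> lpa_component G n) \<and> finite {n. f n \<noteq> \<zero>\<^bsub>LPA\<^esub>} \<and>
      x = (\<Oplus>\<^bsub>LPA\<^esub>n\<in>{n. f n \<noteq> \<zero>\<^bsub>LPA\<^esub>}. f n)"
  proof (rule ex1I[of _ ?f])
    show "(\<forall>n. ?f n \<in> lpa_component G n) \<and> finite ?S \<and> x = (\<Oplus>\<^bsub>LPA\<^esub>n\<in>?S. ?f n)"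
      using component_in[OF p(1)] finS sum by (auto simp: lpa_component_def)
  next
    fix f
    assume "(\<forall>n. f n \<in> lpa_component G n) \<and> finite {n. f n \<noteq> \<zero>\<^bsub>LPA\<^esub>} \<and>
      x = (\<Oplus>\<^bsub>LPA\<^esub>n\<in>{n. f n \<noteq> \<zero>\<^bsub>LPA\<^esub>}. f n)"
    then show "f = ?f" using coset_component_unique[OF p(1), of f] p(2) by blast
  qed
qed

text \<open>
  The quasi-inverse \<open>y\<close> found in the ambient ring is first restricted to words in the generators and
  then replaced by \<open>y p y\<close>, which has no constant term.
\<close>

lemma coset_regular:
  assumes "p \<in> free_component G n"
  shows "\<exists>z\<in>free_carrier G. coset p \<otimes>\<^bsub>LPA\<^esub> coset z \<otimes>\<^bsub>LPA\<^esub> coset p = coset p"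
proof -
  have p: "p \<in> free_carrier G" using assms by (simp add: free_component_def)
  obtain y where y: "p * y * p \<approx> p" using homogeneous_regular[OF assms] by blast
  define y' where "y' = restr (over_gens G) y"
  have "y' \<approx> y"
    by (simp add: y'_def lpa_cong_def restr_diff restr_id over_gens_keys_restr lpa_ideal.zero)
  then have y': "p * y' * p \<approx> p" using cong_trans[OF cong_mid y] by blast
  let ?z = "y' * p * y'"
  have z: "?z \<in> free_carrier G"
    using p by (intro free_carrier_mult_left) (auto simp: y'_def over_gens_keys_restr)
  have "p * ?z * p = p * y' * p * (y' * p)" by (simp add: mult.assoc)
  also have "\<dots> \<approx> p * (y' * p)" using y' by (rule cong_mult_right)
  also have "\<dots> \<approx> p" using y' by (simp add: mult.assoc)
  finally have "p * ?z * p - p \<in> lpa_ideal G"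
    using p z by (simp add: cong_iff_ideal free_carrier_mult)
  then have "coset p \<otimes>\<^bsub>LPA\<^esub> coset ?z \<otimes>\<^bsub>LPA\<^esub> coset p = coset p"
    using p z by (simp add: mult_LPA free_carrier_mult coset_eq_iff)
  with z show ?thesis by blast
qed

end

theorem theorem9:
  fixes G :: "('v, 'e) pre_digraph"
  assumes "wf_digraph G"
  shows "graded_von_neumann_regular
    (leavitt_path_algebra G :: ('v, 'e, 'k::field) lpa_poly set ring) (lpa_component G)"
proof -
  interpret leavitt G "TYPE('k)" by (rule leavitt.intro) (rule assms)
  have "\<exists>y\<in>carrier LPA. x \<otimes>\<^bsub>LPA\<^esub> y \<otimes>\<^bsub>LPA\<^esub> x = x"
    if x: "x \<in> homogeneous_elements (lpa_component G)" for x :: "('v, 'e, 'k) lpa_poly set"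
  proof -
    obtain n p where "p \<in> free_component G n" "x = coset p"
      using x by (auto simp: homogeneous_elements_def lpa_component_def)
    then show ?thesis using coset_regular[of p n] by (auto simp: carrier_LPA)
  qed
  then show ?thesis
    by (simp add: graded_von_neumann_regular_def graded_ring_LPA)
qed

end
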